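(* There is an algorithm (Algorithm MkV) which, given a finite simple graph $G=(V,E)$, a set $S\subseteq V$ and an integer $k\ge 0$, correctly decides whether $S$ is a mutual $k$-visible set of $G$, and runs in time $O\bigl(|S|(|V|+|E|)+|S|^2\bigr)$; in particular the problem is solvable in polynomial time.
   Context: For $X\subseteq V$ and an integer $k\ge 0$, two vertices $u,v\in V$ are $(X,k)$-visible if there exists a shortest $(u,v)$-path in $G$ having at most $k$ internal vertices in $X$. $X$ is a mutual $k$-visible set if every pair of distinct vertices of $X$ is $(X,k)$-visible (in particular, any two vertices of $X$ must be joined by a path). Algorithm MkV: reject if $S$ meets more than one connected component; otherwise, for each $v\in S$, run a breadth-first search from $v$ and then, processing vertices in BFS-layer order, compute for each vertex $w$ the minimum number of vertices of $S\setminus\{v\}$ on a shortest $(v,w)$-path (counting $w$ itself); reject if this value exceeds $k+1$ for some $q\in S\setminus\{v\}$; accept otherwise. *)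

theory Defs
  imports "HOL-Computational_Algebra.Polynomial"
begin

section \<open>Mutual visibility in finite simple graphs\<close>

definition simple_graph :: "'a set \<Rightarrow> 'a set set \<Rightarrow> bool" where
  "simple_graph V E \<longleftrightarrow> finite V \<and> (\<forall>e\<in>E. e \<subseteq> V \<and> card e = 2)"

text \<open>Paths are given by their vertex sequences; the path with \<open>length p\<close> vertices has
  \<open>length p - 1\<close> edges.\<close>

definition is_path :: "'a set \<Rightarrow> 'a set set \<Rightarrow> 'a \<Rightarrow> 'a \<Rightarrow> 'a list \<Rightarrow> bool" where
  "is_path V E u v p \<longleftrightarrow> p \<noteq> [] \<and> hd p = u \<and> last p = v \<and> distinct p \<and> set p \<subseteq> V \<and>
     successively (\<lambda>x y. {x, y} \<in> E) p"

definition shortest_path :: "'a set \<Rightarrow> 'a set set \<Rightarrow> 'a \<Rightarrow> 'a \<Rightarrow> 'a list \<Rightarrow> bool" where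
  "shortest_path V E u v p \<longleftrightarrow> is_path V E u v p \<and>
     (\<forall>q. is_path V E u v q \<longrightarrow> length p \<le> length q)"

definition visible :: "'a set \<Rightarrow> 'a set set \<Rightarrow> 'a set \<Rightarrow> nat \<Rightarrow> 'a \<Rightarrow> 'a \<Rightarrow> bool" where
  "visible V E X k u v \<longleftrightarrow>
     (\<exists>p. shortest_path V E u v p \<and> card ((set p - {u, v}) \<inter> X) \<le> k)"

definition mutual_visible :: "'a set \<Rightarrow> 'a set set \<Rightarrow> nat \<Rightarrow> 'a set \<Rightarrow> bool" where
  "mutual_visible V E k X \<longleftrightarrow> (\<forall>u\<in>X. \<forall>v\<in>X. u \<noteq> v \<longrightarrow> visible V E X k u v)"


section \<open>A small imperative language with unit-cost random access\<close>

text \<open>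
  A random access machine in structured form: the memory consists of named registers and named
  arrays of natural numbers, and array cells are read and written in constant time. Addition is
  the only arithmetic operation, so each unit of cost increases the bit length of the largest
  number in memory by at most one (apart from the constants of the program); hence polynomial
  time has its usual meaning in spite of the unit cost.
\<close>

type_synonym name = string

datatype aexp =
    Const nat
  | Var name
  | Get name aexp
  | Add aexp aexp

datatype bexp =
    Less aexp aexp
  | Equal aexp aexp
  | Neg bexp
  | Conj bexp bexp

datatype com =
    SKIP
  | Assign name aexp        ("_ ::= _" [1000, 61] 61)
  | Store name aexp aexp    ("_ \<langle>_\<rangle> ::= _" [1000, 0, 61] 61)
  | Seq com com             (infixr ";;" 60)
  | If bexp com com         ("(IF _/ THEN _/ ELSE _)" [0, 0, 61] 61)
  | While bexp com          ("(WHILE _/ DO _)" [0, 61] 61)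

type_synonym state = "(name \<Rightarrow> nat) \<times> (name \<Rightarrow> nat \<Rightarrow> nat)"

primrec aval :: "aexp \<Rightarrow> state \<Rightarrow> nat" where
  "aval (Const c) st = c"
| "aval (Var x) st = fst st x"
| "aval (Get A a) st = snd st A (aval a st)"
| "aval (Add a b) st = aval a st + aval b st"

primrec bval :: "bexp \<Rightarrow> state \<Rightarrow> bool" where
  "bval (Less a b) st \<longleftrightarrow> aval a st < aval b st"
| "bval (Equal a b) st \<longleftrightarrow> aval a st = aval b st"
| "bval (Neg b) st \<longleftrightarrow> \<not> bval b st"
| "bval (Conj b c) st \<longleftrightarrow> bval b st \<and> bval c st"

text \<open>Every node of an expression costs one step.\<close>

primrec acost :: "aexp \<Rightarrow> nat" where
  "acost (Const c) = 1"
| "acost (Var x) = 1"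
| "acost (Get A a) = 1 + acost a"
| "acost (Add a b) = 1 + acost a + acost b"

primrec bcost :: "bexp \<Rightarrow> nat" where
  "bcost (Less a b) = 1 + acost a + acost b"
| "bcost (Equal a b) = 1 + acost a + acost b"
| "bcost (Neg b) = 1 + bcost b"
| "bcost (Conj b c) = 1 + bcost b + bcost c"

text \<open>\<open>exec c st t st'\<close>: started in state \<open>st\<close>, the program \<open>c\<close> terminates in state \<open>st'\<close> after
  exactly \<open>t\<close> steps.\<close>

inductive exec :: "com \<Rightarrow> state \<Rightarrow> nat \<Rightarrow> state \<Rightarrow> bool" where
  Skip: "exec SKIP st 1 st"
| Assign: "exec (x ::= a) (s, h) (1 + acost a) (s(x := aval a (s, h)), h)"
| Store: "exec (A\<langle>a\<rangle> ::= b) (s, h) (1 + acost a + acost b)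
            (s, h(A := (h A)(aval a (s, h) := aval b (s, h))))"
| Seq: "exec c st t st' \<Longrightarrow> exec d st' t' st'' \<Longrightarrow> exec (c ;; d) st (t + t') st''"
| IfTrue: "bval b st \<Longrightarrow> exec c st t st' \<Longrightarrow>
            exec (IF b THEN c ELSE d) st (1 + bcost b + t) st'"
| IfFalse: "\<not> bval b st \<Longrightarrow> exec d st t st' \<Longrightarrow>
            exec (IF b THEN c ELSE d) st (1 + bcost b + t) st'"
| WhileFalse: "\<not> bval b st \<Longrightarrow> exec (WHILE b DO c) st (1 + bcost b) st"
| WhileTrue: "bval b st \<Longrightarrow> exec c st t st' \<Longrightarrow> exec (WHILE b DO c) st' t' st'' \<Longrightarrow>
            exec (WHILE b DO c) st (1 + bcost b + t + t') st''"

inductive_cases exec_SkipE: "exec SKIP st t st'"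
  and exec_AssignE: "exec (x ::= a) st t st'"
  and exec_StoreE: "exec (A\<langle>a\<rangle> ::= b) st t st'"
  and exec_SeqE: "exec (c ;; d) st t st'"
  and exec_IfE: "exec (IF b THEN c ELSE d) st t st'"
  and exec_WhileE: "exec (WHILE b DO c) st t st'"

lemma exec_deterministic:
  "exec c st t st' \<Longrightarrow> exec c st u su \<Longrightarrow> t = u \<and> st' = su"
proof (induction arbitrary: u su rule: exec.induct)
  case (Seq c st t st' d t' st'')
  from Seq.prems show ?case by (rule exec_SeqE) (metis Seq.IH)
next
  case (IfTrue b st c t st' d)
  from IfTrue.prems show ?case by (rule exec_IfE) (use IfTrue.hyps in \<open>auto dest!: IfTrue.IH\<close>)
next
  case (IfFalse b st d t st' c)
  from IfFalse.prems show ?case by (rule exec_IfE) (use IfFalse.hyps in \<open>auto dest!: IfFalse.IH\<close>)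
next
  case (WhileFalse b st c)
  from WhileFalse.prems show ?case by (rule exec_WhileE) (use WhileFalse.hyps in simp_all)
next
  case (WhileTrue b st c t st' t' st'')
  from WhileTrue.prems obtain t1 s1 t2 where *: "u = 1 + bcost b + t1 + t2"
    "exec c st t1 s1" "exec (WHILE b DO c) s1 t2 su"
    by (rule exec_WhileE) (use WhileTrue.hyps in auto)
  from WhileTrue.IH(1)[OF *(2)] WhileTrue.IH(2) * show ?case by blast
next
  case (Assign x a s h)
  from Assign.prems show ?case by (rule exec_AssignE) simp
next
  case (Store A a b s h)
  from Store.prems show ?case by (rule exec_StoreE) simp
next
  case (Skip st)
  from Skip.prems show ?case by (rule exec_SkipE) simp
qed


section \<open>Representation of the input and acceptance\<close>

text \<open>
  The vertices are numbered by \<open>num\<close>. Register \<open>n\<close> holds the number of vertices, \<open>s\<close> the size of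
  the vertex set and \<open>k\<close> the integer parameter. The graph is given by adjacency lists: the
  neighbours of the vertex with number \<open>i\<close> are listed, without repetition and in any order, in
  the cells \<open>off i, ..., off (i + 1) - 1\<close> of the array \<open>adj\<close>. The array \<open>S\<close> lists the vertex set.
  All other registers and cells have arbitrary contents.
\<close>

definition encodes ::
  "('a \<Rightarrow> nat) \<Rightarrow> state \<Rightarrow> 'a set \<Rightarrow> 'a set set \<Rightarrow> 'a set \<Rightarrow> nat \<Rightarrow> bool" where
  "encodes num st V E S k \<longleftrightarrow>
     bij_betw num V {..<card V} \<and>
     fst st ''n'' = card V \<and> fst st ''s'' = card S \<and> fst st ''k'' = k \<and>
     snd st ''off'' 0 = 0 \<and>
     (\<forall>i<card V. snd st ''off'' i \<le> snd st ''off'' (i + 1)) \<and>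
     (\<forall>u\<in>V. bij_betw (snd st ''adj'')
        {snd st ''off'' (num u)..<snd st ''off'' (num u + 1)} (num ` {w\<in>V. {u, w} \<in> E})) \<and>
     bij_betw (snd st ''S'') {..<card S} (num ` S)"

definition accepts :: "state \<Rightarrow> bool" where
  "accepts st \<longleftrightarrow> fst st ''ok'' = 1"

definition decides_mutual_visible_within ::
  "com \<Rightarrow> 'a set \<Rightarrow> 'a set set \<Rightarrow> 'a set \<Rightarrow> nat \<Rightarrow> nat \<Rightarrow> bool" where
  "decides_mutual_visible_within c V E S k T \<longleftrightarrow>
     (\<forall>num st. encodes num st V E S k \<longrightarrow>
        (\<exists>t st'. exec c st t st' \<and> t \<le> T \<and> (accepts st' \<longleftrightarrow> mutual_visible V E k S)))"


section \<open>Algorithm MkV\<close>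

text \<open>Distances are smaller than \<open>n\<close>, so \<open>n\<close> marks the vertices that have not been reached.\<close>

definition BFS :: com where
  "BFS =
     ''a'' ::= Const 0 ;;
     WHILE Less (Var ''a'') (Var ''n'') DO (
       ''dist''\<langle>Var ''a''\<rangle> ::= Var ''n'' ;;
       ''a'' ::= Add (Var ''a'') (Const 1)) ;;
     ''dist''\<langle>Var ''v''\<rangle> ::= Const 0 ;;
     ''queue''\<langle>Const 0\<rangle> ::= Var ''v'' ;;
     ''head'' ::= Const 0 ;;
     ''tail'' ::= Const 1 ;;
     WHILE Less (Var ''head'') (Var ''tail'') DO (
       ''u'' ::= Get ''queue'' (Var ''head'') ;;
       ''head'' ::= Add (Var ''head'') (Const 1) ;;
       ''e'' ::= Get ''off'' (Var ''u'') ;;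
       WHILE Less (Var ''e'') (Get ''off'' (Add (Var ''u'') (Const 1))) DO (
         ''x'' ::= Get ''adj'' (Var ''e'') ;;
         IF Equal (Get ''dist'' (Var ''x'')) (Var ''n'') THEN (
           ''dist''\<langle>Var ''x''\<rangle> ::= Add (Get ''dist'' (Var ''u'')) (Const 1) ;;
           ''queue''\<langle>Var ''tail''\<rangle> ::= Var ''x'' ;;
           ''tail'' ::= Add (Var ''tail'') (Const 1))
         ELSE SKIP ;;
         ''e'' ::= Add (Var ''e'') (Const 1)))"

text \<open>The set meets only one connected component iff all its members are reached from the first
  one.\<close>

definition check_component :: com where
  "check_component =
     ''v'' ::= Get ''S'' (Const 0) ;;
     BFS ;;
     ''j'' ::= Const 0 ;;
     WHILE Less (Var ''j'') (Var ''s'') DO (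
       IF Equal (Get ''dist'' (Get ''S'' (Var ''j''))) (Var ''n'')
       THEN ''ok'' ::= Const 0 ELSE SKIP ;;
       ''j'' ::= Add (Var ''j'') (Const 1))"

definition mark_S :: com where
  "mark_S =
     ''a'' ::= Const 0 ;;
     WHILE Less (Var ''a'') (Var ''n'') DO (
       ''inS''\<langle>Var ''a''\<rangle> ::= Const 0 ;;
       ''a'' ::= Add (Var ''a'') (Const 1)) ;;
     ''j'' ::= Const 0 ;;
     WHILE Less (Var ''j'') (Var ''s'') DO (
       ''inS''\<langle>Get ''S'' (Var ''j'')\<rangle> ::= Const 1 ;;
       ''j'' ::= Add (Var ''j'') (Const 1))"

text \<open>
  After \<open>BFS\<close> the cells \<open>0, ..., tail - 1\<close> of the array \<open>queue\<close> contain the reached vertices in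
  order of their layers, with \<open>v\<close> in cell \<open>0\<close>. The value \<open>cnt w\<close> is the minimum of \<open>cnt x\<close> over
  the neighbours \<open>x\<close> of \<open>w\<close> in the previous layer, plus one if \<open>w\<close> belongs to the set; here
  \<open>w\<close> is never \<open>v\<close>, and \<open>n\<close> exceeds every \<open>cnt x\<close>.
\<close>

definition count_layers :: com where
  "count_layers =
     ''cnt''\<langle>Var ''v''\<rangle> ::= Const 0 ;;
     ''h'' ::= Const 1 ;;
     WHILE Less (Var ''h'') (Var ''tail'') DO (
       ''w'' ::= Get ''queue'' (Var ''h'') ;;
       ''best'' ::= Var ''n'' ;;
       ''e'' ::= Get ''off'' (Var ''w'') ;;
       WHILE Less (Var ''e'') (Get ''off'' (Add (Var ''w'') (Const 1))) DO (
         ''x'' ::= Get ''adj'' (Var ''e'') ;;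
         IF Conj (Equal (Add (Get ''dist'' (Var ''x'')) (Const 1)) (Get ''dist'' (Var ''w'')))
                 (Less (Get ''cnt'' (Var ''x'')) (Var ''best''))
         THEN ''best'' ::= Get ''cnt'' (Var ''x'') ELSE SKIP ;;
         ''e'' ::= Add (Var ''e'') (Const 1)) ;;
       ''cnt''\<langle>Var ''w''\<rangle> ::= Add (Var ''best'') (Get ''inS'' (Var ''w'')) ;;
       ''h'' ::= Add (Var ''h'') (Const 1))"

definition check_counts :: com where
  "check_counts =
     ''j'' ::= Const 0 ;;
     WHILE Less (Var ''j'') (Var ''s'') DO (
       ''q'' ::= Get ''S'' (Var ''j'') ;;
       IF Conj (Neg (Equal (Var ''q'') (Var ''v'')))
               (Less (Add (Var ''k'') (Const 1)) (Get ''cnt'' (Var ''q'')))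
       THEN ''ok'' ::= Const 0 ELSE SKIP ;;
       ''j'' ::= Add (Var ''j'') (Const 1))"

definition MkV :: com where
  "MkV =
     ''ok'' ::= Const 1 ;;
     IF Less (Const 0) (Var ''s'') THEN (
       check_component ;;
       mark_S ;;
       ''i'' ::= Const 0 ;;
       WHILE Conj (Equal (Var ''ok'') (Const 1)) (Less (Var ''i'') (Var ''s'')) DO (
         ''v'' ::= Get ''S'' (Var ''i'') ;;
         BFS ;;
         count_layers ;;
         check_counts ;;
         ''i'' ::= Add (Var ''i'') (Const 1)))
     ELSE SKIP"

end

theory Submission
  imports Defs
begin

text \<open>
  Number the vertices by \<open>{..<n}\<close>. What breadth-first search establishes is a local certificate: every
  reached vertex except the source has a neighbour one layer below, and no edge leaving a reached
  vertex skips a layer. It follows that the shortest paths from the source are exactly the walks that climb one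
  layer per step, so the least number of members of the set on such a walk to \<open>w\<close> satisfies the
  recursion that the second pass evaluates in queue order. For \<open>w\<close> in the set the count includes \<open>w\<close>
  itself, which accounts for the threshold \<open>k + 1\<close>. For the time bound, each pass scans the
  adjacency list of every queued vertex once, at most \<open>2 |E|\<close> cells in total.
\<close>

section \<open>Weakest preconditions with a running clock\<close>

text \<open>Determinism of \<open>exec\<close> makes total correctness and running time a single
  statement: \<open>wp\<close> carries a clock, so a time bound is an ordinary conjunct of a loop
  invariant. The obstacle on the graph side is the label \<open>n\<close> for unreached vertices:
  labels and counts of reached vertices must be shown to stay below it. Bounding both by the
  position in the queue achieves this, because the queue lists distinct vertices. Reachability is
  tested only from the first member of the set. Later rounds read \<open>cnt\<close> of every member
  without looking at \<open>dist\<close>, so an unreached member would contribute a stale cell;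
  symmetry of reachability rules this out. All of this is carried out on numbers. Visibility is
  invariant under the isomorphism \<open>num\<close>, which transfers the result to vertices of any
  type. The numeric constants are step counts, generously rounded up.\<close>

definition wp :: "com \<Rightarrow> (nat \<Rightarrow> state \<Rightarrow> bool) \<Rightarrow> nat \<Rightarrow> state \<Rightarrow> bool" where
  "wp c Q t st \<longleftrightarrow> (\<exists>u st'. exec c st u st' \<and> Q (t + u) st')"

text \<open>A command has at most one outcome, so any known execution decides the existential in
  \<open>wp\<close>. This turns the rules for atomic commands into equations for the
  simplifier.\<close>

lemma wp_exec: "exec c st u st' \<Longrightarrow> wp c Q t st = Q (t + u) st'"
  unfolding wp_def using exec_deterministic by blast

lemma wp_SKIP [simp]: "wp SKIP Q t st = Q (t + 1) st"
  by (rule wp_exec[OF exec.Skip])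

lemma wp_Assign [simp]:
  "wp (x ::= a) Q t st = Q (t + (1 + acost a)) ((fst st)(x := aval a st), snd st)"
  by (cases st) (simp only: wp_exec[OF exec.Assign] fst_conv snd_conv)

lemma wp_Store [simp]:
  "wp (A\<langle>a\<rangle> ::= b) Q t st = Q (t + (1 + acost a + acost b))
     (fst st, (snd st)(A := (snd st A)(aval a st := aval b st)))"
  by (cases st) (simp only: wp_exec[OF exec.Store] fst_conv snd_conv)

lemma wp_Seq [simp]: "wp (c ;; d) Q t st = wp c (wp d Q) t st"
  unfolding wp_def by (metis (no_types, lifting) add.assoc exec.Seq exec_SeqE)

lemma wp_If [simp]:
  "wp (IF b THEN c ELSE d) Q t st =
     (if bval b st then wp c Q (t + (1 + bcost b)) st else wp d Q (t + (1 + bcost b)) st)"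
proof -
  have "exec (IF b THEN c ELSE d) st u st' \<longleftrightarrow>
      (\<exists>w. u = 1 + bcost b + w \<and> exec (if bval b st then c else d) st w st')" for u st'
  proof
    assume "exec (IF b THEN c ELSE d) st u st'"
    then show "\<exists>w. u = 1 + bcost b + w \<and> exec (if bval b st then c else d) st w st'"
      by (rule exec_IfE) auto
  next
    assume "\<exists>w. u = 1 + bcost b + w \<and> exec (if bval b st then c else d) st w st'"
    then obtain w where "u = 1 + bcost b + w" "exec (if bval b st then c else d) st w st'"
      by blast
    then show "exec (IF b THEN c ELSE d) st u st'"
      using exec.IfTrue[of b st c w st' d] exec.IfFalse[of b st d w st' c]
      by (cases "bval b st") simp_all
  qed
  then have "wp (IF b THEN c ELSE d) Q t st =
      wp (if bval b st then c else d) Q (t + (1 + bcost b)) st"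
    unfolding wp_def by (metis (no_types, lifting) add.assoc)
  then show ?thesis
    by (cases "bval b st") (simp_all only: if_True if_False)
qed

section \<open>Frame conditions read off the program text\<close>

primrec assigned :: "com \<Rightarrow> name set" where
  "assigned SKIP = {}"
| "assigned (x ::= a) = {x}"
| "assigned (A\<langle>a\<rangle> ::= b) = {}"
| "assigned (c ;; d) = assigned c \<union> assigned d"
| "assigned (IF b THEN c ELSE d) = assigned c \<union> assigned d"
| "assigned (WHILE b DO c) = assigned c"

primrec stored :: "com \<Rightarrow> name set" where
  "stored SKIP = {}"
| "stored (x ::= a) = {}"
| "stored (A\<langle>a\<rangle> ::= b) = {A}"
| "stored (c ;; d) = stored c \<union> stored d"
| "stored (IF b THEN c ELSE d) = stored c \<union> stored d"
| "stored (WHILE b DO c) = stored c"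

definition frame :: "com \<Rightarrow> state \<Rightarrow> state \<Rightarrow> bool" where
  "frame c st st' \<longleftrightarrow> (\<forall>x. x \<notin> assigned c \<longrightarrow> fst st' x = fst st x) \<and>
     (\<forall>A. A \<notin> stored c \<longrightarrow> snd st' A = snd st A)"

lemma frame_fst: "frame c st st' \<Longrightarrow> x \<notin> assigned c \<Longrightarrow> fst st' x = fst st x"
  and frame_snd: "frame c st st' \<Longrightarrow> A \<notin> stored c \<Longrightarrow> snd st' A = snd st A"
  by (auto simp: frame_def)

lemma frame_refl: "frame c st st"
  by (simp add: frame_def)

lemma frame_trans: "frame c st st' \<Longrightarrow> frame c st' st'' \<Longrightarrow> frame c st st''"
  by (simp add: frame_def)

lemma exec_frame: "exec c st t st' \<Longrightarrow> frame c st st'"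
  by (induction rule: exec.induct) (auto simp: frame_def)

text \<open>The frame comes with every consequence step, so postconditions need to mention only what
  the command can write.\<close>

lemma wp_conseq:
  assumes "wp c P t st" and "\<And>t' st'. P t' st' \<Longrightarrow> frame c st st' \<Longrightarrow> Q t' st'"
  shows "wp c Q t st"
  using assms exec_frame unfolding wp_def by blast

text \<open>\<open>I\<close> sees the clock and \<open>m\<close> gives termination. The frame
  relative to loop entry is propagated by transitivity, so invariants need not repeat it. The
  failing test is charged too, hence \<open>1 + bcost b\<close> on exit.\<close>

lemma wp_While:
  fixes m :: "state \<Rightarrow> nat"
  assumes "I t st"
    and step: "\<And>t' st'. I t' st' \<Longrightarrow> frame c st st' \<Longrightarrow> bval b st' \<Longrightarrow>
      wp c (\<lambda>t'' st''. I t'' st'' \<and> m st'' < m st') (t' + (1 + bcost b)) st'"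
    and "\<And>t' st'. I t' st' \<Longrightarrow> frame c st st' \<Longrightarrow> \<not> bval b st' \<Longrightarrow> Q (t' + (1 + bcost b)) st'"
  shows "wp (WHILE b DO c) Q t st"
proof -
  have "wp (WHILE b DO c) Q t' st'" if "I t' st'" "frame c st st'" for t' st'
    using that
  proof (induction "m st'" arbitrary: t' st' rule: less_induct)
    case less
    show ?case
    proof (cases "bval b st'")
      case True
      obtain u st'' where u: "exec c st' u st''" "I (t' + (1 + bcost b) + u) st''" "m st'' < m st'"
        using step[OF less.prems True] unfolding wp_def by blast
      have "wp (WHILE b DO c) Q (t' + (1 + bcost b) + u) st''"
        using less.hyps u frame_trans[OF less.prems(2) exec_frame[OF u(1)]] by blast
      then obtain w st3 where w: "exec (WHILE b DO c) st'' w st3" "Q (t' + (1 + bcost b) + u + w) st3"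
        unfolding wp_def by blast
      have "Q (t' + (1 + bcost b + u + w)) st3"
        using w(2) by (simp add: add.assoc)
      then show ?thesis
        unfolding wp_def using exec.WhileTrue[OF True u(1) w(1)] by blast
    next
      case False
      then show ?thesis
        unfolding wp_def using assms(3)[OF less.prems] exec.WhileFalse by blast
    qed
  qed
  then show ?thesis
    using assms(1) frame_refl by blast
qed

section \<open>Breadth-first search on a graph in adjacency-list form\<close>

locale adjacency =
  fixes n :: nat and E :: "nat set set" and off adj :: "nat \<Rightarrow> nat"
  assumes graph: "simple_graph {..<n} E"
    and off_0: "off 0 = 0"
    and off_mono: "\<And>i. i < n \<Longrightarrow> off i \<le> off (Suc i)"
    and adj_bij: "\<And>u. u < n \<Longrightarrow> bij_betw adj {off u..<off (Suc u)} {w. {u, w} \<in> E}"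
begin

lemma edgeD: "{u, w} \<in> E \<Longrightarrow> u < n \<and> w < n \<and> u \<noteq> w"
  using graph unfolding simple_graph_def by (fastforce simp: card_2_iff)

lemma finite_E: "finite E"
  using graph unfolding simple_graph_def by (meson finite_Pow_iff finite_subset PowI subsetI)

lemma adj_image: "u < n \<Longrightarrow> adj ` {off u..<off (Suc u)} = {w. {u, w} \<in> E}"
  using adj_bij by (simp add: bij_betw_def)

lemma adj_edge: "u < n \<Longrightarrow> off u \<le> e \<Longrightarrow> e < off (Suc u) \<Longrightarrow> {u, adj e} \<in> E"
  using adj_image[of u] by auto

section \<open>Degree sums, the budget for all adjacency scans\<close>

definition deg :: "nat \<Rightarrow> nat" where
  "deg u = off (Suc u) - off u"

text \<open>Double counting of the pairs \<open>(u, w)\<close> that form an edge: grouped by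
  \<open>u\<close> they give the degrees, grouped by edge at most two each.\<close>

lemma sum_deg: "(\<Sum>u<n. deg u) \<le> 2 * card E"
proof -
  have "(\<Sum>u<n. deg u) = (\<Sum>u<n. card {w. {u, w} \<in> E})"
    by (rule sum.cong) (auto simp: deg_def dest!: adj_bij bij_betw_same_card)
  also have "\<dots> = card (SIGMA u:{..<n}. {w. {u, w} \<in> E})"
    by (rule card_SigmaI[symmetric]) (auto intro: finite_subset[of _ "{..<n}"] dest: edgeD)
  also have "(SIGMA u:{..<n}. {w. {u, w} \<in> E}) = (\<Union>e\<in>E. {(u, w). {u, w} = e})"
    by (auto dest: edgeD)
  also have "card \<dots> \<le> (\<Sum>e\<in>E. card {(u, w). {u, w} = e})"
    by (rule card_UN_le[OF finite_E])
  also have "\<dots> \<le> (\<Sum>e\<in>E. 2)"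
  proof (rule sum_mono)
    fix e assume "e \<in> E"
    then have "card e = 2"
      using graph by (simp add: simple_graph_def)
    then obtain a b where "e = {a, b}"
      by (auto simp: card_2_iff)
    then have "{(u, w). {u, w} = e} \<subseteq> {(a, b), (b, a)}"
      by (auto simp: doubleton_eq_iff)
    then have "card {(u, w). {u, w} = e} \<le> card {(a, b), (b, a)}"
      by (rule card_mono[rotated]) simp
    also have "\<dots> \<le> 2"
      using card_length[of "[(a, b), (b, a)]"] by simp
    finally show "card {(u, w). {u, w} = e} \<le> 2" .
  qed
  finally show ?thesis
    by simp
qed

lemma sum_deg_inj:
  assumes "inj_on q {..<m}" and "q ` {..<m} \<subseteq> {..<n}"
  shows "(\<Sum>i<m. deg (q i)) \<le> 2 * card E"
proof -
  have "(\<Sum>i<m. deg (q i)) = sum deg (q ` {..<m})"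
    using assms(1) by (simp add: sum.reindex)
  also have "\<dots> \<le> (\<Sum>u<n. deg u)"
    using assms(2) by (intro sum_mono2) auto
  finally show ?thesis
    using sum_deg by simp
qed

text \<open>The clause \<open>D (q i) <= i\<close> serves the marker: since \<open>m <= n\<close>,
  it keeps the labels of queued vertices below \<open>n\<close>. The last two clauses are layer
  order and the parent in the search tree.\<close>

definition queue_inv :: "nat \<Rightarrow> (nat \<Rightarrow> nat) \<Rightarrow> (nat \<Rightarrow> nat) \<Rightarrow> nat \<Rightarrow> bool" where
  "queue_inv v D q m \<longleftrightarrow> 0 < m \<and> q 0 = v \<and> D v = 0 \<and> inj_on q {..<m} \<and>
     q ` {..<m} = {w. w < n \<and> D w \<noteq> n} \<and>
     (\<forall>i<m. D (q i) \<le> i) \<and> (\<forall>i j. i \<le> j \<longrightarrow> j < m \<longrightarrow> D (q i) \<le> D (q j)) \<and>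
     (\<forall>i. 0 < i \<longrightarrow> i < m \<longrightarrow> (\<exists>x. {x, q i} \<in> E \<and> D x \<noteq> n \<and> D (q i) = Suc (D x)))"

text \<open>The queue never spans more than two layers: this is what makes a vertex that has already been
  reached when it is seen from \<open>u\<close> lie at most one layer after \<open>u\<close>.\<close>

definition bfs_inv :: "nat \<Rightarrow> (nat \<Rightarrow> nat) \<Rightarrow> (nat \<Rightarrow> nat) \<Rightarrow> nat \<Rightarrow> nat \<Rightarrow> bool" where
  "bfs_inv v D q h m \<longleftrightarrow> queue_inv v D q m \<and> h \<le> m \<and>
     (\<forall>i<h. \<forall>w. {q i, w} \<in> E \<longrightarrow> D w \<noteq> n \<and> D w \<le> Suc (D (q i))) \<and>
     (\<forall>i j. h \<le> i \<longrightarrow> i < m \<longrightarrow> j < m \<longrightarrow> D (q j) \<le> Suc (D (q i)))"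

text \<open>The state in the middle of the adjacency list of \<open>u\<close>, with \<open>X\<close>
  the neighbours already examined; \<open>h\<close> is still the cell of \<open>u\<close>, although
  the program has already advanced \<open>head\<close>. The two-layer condition is kept relative to
  \<open>u\<close> only.\<close>

definition scan_inv ::
  "nat \<Rightarrow> nat \<Rightarrow> nat \<Rightarrow> (nat \<Rightarrow> nat) \<Rightarrow> (nat \<Rightarrow> nat) \<Rightarrow> nat \<Rightarrow> nat set \<Rightarrow> bool" where
  "scan_inv v u h D q m X \<longleftrightarrow> queue_inv v D q m \<and> h < m \<and> q h = u \<and>
     (\<forall>i<h. \<forall>w. {q i, w} \<in> E \<longrightarrow> D w \<noteq> n \<and> D w \<le> Suc (D (q i))) \<and>
     (\<forall>j<m. D (q j) \<le> Suc (D u)) \<and> (\<forall>w\<in>X. D w \<noteq> n \<and> D w \<le> Suc (D u))"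

lemma queue_inv_reached:
  assumes "queue_inv v D q m" and "i < m"
  shows "q i < n \<and> D (q i) \<noteq> n"
proof -
  have "q i \<in> q ` {..<m}"
    using assms(2) by simp
  then show ?thesis
    using assms(1) by (simp add: queue_inv_def)
qed

lemma queue_inv_index: "queue_inv v D q m \<Longrightarrow> w < n \<Longrightarrow> D w \<noteq> n \<Longrightarrow> \<exists>i<m. w = q i"
  unfolding queue_inv_def by blast

lemma queue_inv_le: "queue_inv v D q m \<Longrightarrow> m \<le> n"
  using card_inj_on_le[of q "{..<m}" "{..<n}"] unfolding queue_inv_def by auto

lemma bfs_init: "v < n \<Longrightarrow> \<forall>w<n. D w = n \<Longrightarrow> bfs_inv v (D(v := 0)) (q(0 := v)) 0 1"
  by (auto simp: bfs_inv_def queue_inv_def inj_on_def split: if_splits)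

lemma scan_start: "bfs_inv v D q h m \<Longrightarrow> h < m \<Longrightarrow> scan_inv v (q h) h D q m {}"
  by (auto simp: bfs_inv_def scan_inv_def)

text \<open>Labels do not decrease along the queue, so a bound relative to \<open>u\<close> in cell
  \<open>h\<close> passes to every later cell.\<close>

lemma scan_end:
  assumes "scan_inv v u h D q m {w. {u, w} \<in> E}"
  shows "bfs_inv v D q (Suc h) m"
proof -
  have inv: "queue_inv v D q m" "h < m" "q h = u" "\<And>j. j < m \<Longrightarrow> D (q j) \<le> Suc (D u)"
    and mono: "\<And>i j. i \<le> j \<Longrightarrow> j < m \<Longrightarrow> D (q i) \<le> D (q j)"
    using assms by (auto simp: scan_inv_def queue_inv_def)
  have "D (q j) \<le> Suc (D (q i))" if "Suc h \<le> i" "i < m" "j < m" for i j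
    using inv(3) inv(4)[of j] mono[of h i] that by fastforce
  then show ?thesis
    using inv(1,2) assms unfolding bfs_inv_def scan_inv_def less_Suc_eq by auto
qed

text \<open>A labelled neighbour sits in the queue, where every label is at most
  \<open>Suc (D u)\<close>.\<close>

lemma scan_skip:
  assumes "scan_inv v u h D q m X" and "{u, x} \<in> E" and "D x \<noteq> n"
  shows "scan_inv v u h D q m (insert x X)"
proof -
  have "x < n"
    using assms(2) edgeD by blast
  then obtain j where "j < m" "x = q j"
    using assms queue_inv_index unfolding scan_inv_def by blast
  then show ?thesis
    using assms unfolding scan_inv_def by auto
qed

text \<open>Appending keeps the queue sorted because all labels in it are at most
  \<open>Suc (D u)\<close>. The new label is not the marker, as
  \<open>D u <= h < m < n\<close>.\<close>

lemma scan_push: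
  assumes inv: "scan_inv v u h D q m X" and ux: "{u, x} \<in> E" and Dx: "D x = n"
  shows "scan_inv v u h (D(x := Suc (D u))) (q(m := x)) (Suc m) (insert x X)"
proof -
  let ?D = "D(x := Suc (D u))" and ?q = "q(m := x)"
  have x: "x < n" and q: "queue_inv v D q m" and h: "h < m" "q h = u"
    using edgeD[OF ux] inv by (auto simp: scan_inv_def)
  have q0: "q 0 = v" "D v = 0" "0 < m" and inj: "inj_on q {..<m}"
    and img: "q ` {..<m} = {w. w < n \<and> D w \<noteq> n}" and Di: "\<And>i. i < m \<Longrightarrow> D (q i) \<le> i"
    and mono: "\<And>i j. i \<le> j \<Longrightarrow> j < m \<Longrightarrow> D (q i) \<le> D (q j)"
    and par: "\<And>i. 0 < i \<Longrightarrow> i < m \<Longrightarrow> \<exists>y. {y, q i} \<in> E \<and> D y \<noteq> n \<and> D (q i) = Suc (D y)"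
    using q by (simp_all add: queue_inv_def)
  have ne: "q i \<noteq> x" if "i < m" for i
    using queue_inv_reached[OF q that] Dx by auto
  \<comment> \<open>Pigeonhole: the \<open>m\<close> distinct queued vertices all differ from
    \<open>x\<close>, so \<open>m < n\<close>.\<close>
  have "card (q ` {..<m}) \<le> card ({..<n} - {x})"
    using queue_inv_reached[OF q] ne by (intro card_mono) auto
  then have m: "m < n"
    using x card_image[OF inj] by simp
  have Du: "D u \<le> h"
    using Di h by blast
  have "?q ` {..<Suc m} = insert x (q ` {..<m})"
    by (auto simp: lessThan_Suc)
  also have "\<dots> = {w. w < n \<and> ?D w \<noteq> n}"
    using img x m Du h(1) by auto
  finally have img': "?q ` {..<Suc m} = {w. w < n \<and> ?D w \<noteq> n}" .
  have parent: "\<exists>y. {y, ?q i} \<in> E \<and> ?D y \<noteq> n \<and> ?D (?q i) = Suc (?D y)" if i: "0 < i" "i < Suc m" for i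
  proof (cases "i = m")
    case True
    then show ?thesis
      using ux ne h queue_inv_reached[OF q h(1)] by (intro exI[of _ u]) auto
  next
    case False
    then have "i < m"
      using i by simp
    then obtain y where "{y, q i} \<in> E" "D y \<noteq> n" "D (q i) = Suc (D y)"
      using par[OF i(1)] by blast
    then show ?thesis
      using False ne[OF \<open>i < m\<close>] Dx by (intro exI[of _ y]) auto
  qed
  have "?q 0 = v" "?D v = 0"
    using q0 ne[of 0] by auto
  moreover have "inj_on ?q {..<Suc m}"
    using inj ne by (auto simp: lessThan_Suc inj_on_def)
  moreover have "\<forall>i<Suc m. ?D (?q i) \<le> i"
    using Di ne Du h(1) by (auto simp: less_Suc_eq)
  moreover have "\<forall>i j. i \<le> j \<longrightarrow> j < Suc m \<longrightarrow> ?D (?q i) \<le> ?D (?q j)"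
    using inv ne mono by (auto simp: scan_inv_def less_Suc_eq)
  ultimately have "queue_inv v ?D ?q (Suc m)"
    unfolding queue_inv_def using img' parent by blast
  moreover have "u \<noteq> x" "Suc (D u) \<noteq> n"
    using ne h Du m by auto
  ultimately show ?thesis
    using inv ne Dx unfolding scan_inv_def by (auto simp: less_Suc_eq)
qed

end

text \<open>Covers both the reset of \<open>dist\<close>, where \<open>b\<close> reads register
  \<open>n\<close>, and that of \<open>inS\<close>, where \<open>b\<close> is a constant.\<close>

lemma wp_fill:
  assumes "\<And>st'. fst st' ''n'' = fst st ''n'' \<Longrightarrow> aval b st' = c" and "acost b = 1"
    and "fst st ''a'' = 0"
  shows "wp (WHILE Less (Var ''a'') (Var ''n'') DO (
       A\<langle>Var ''a''\<rangle> ::= b ;;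
       ''a'' ::= Add (Var ''a'') (Const 1)))
     (\<lambda>t' st'. t' \<le> t + 15 * fst st ''n'' + 5 \<and> (\<forall>i<fst st ''n''. snd st' A i = c)) t st"
proof (rule wp_While[where I = "\<lambda>t' st'. fst st' ''a'' \<le> fst st ''n'' \<and>
      (\<forall>i<fst st' ''a''. snd st' A i = c) \<and> t' \<le> t + 15 * fst st' ''a''"
      and m = "\<lambda>st'. fst st ''n'' - fst st' ''a''"], goal_cases)
  case 1
  then show ?case
    using assms(3) by simp
next
  case (2 t' st')
  have n: "fst st' ''n'' = fst st ''n''"
    using frame_fst[OF 2(2), of "''n''"] by simp
  show ?case
    using 2 assms(1)[OF n] assms(2) n by (auto simp: less_Suc_eq)
next
  case (3 t' st')
  have n: "fst st' ''n'' = fst st ''n''"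
    using frame_fst[OF 3(2), of "''n''"] by simp
  then show ?case
    using 3 by auto
qed

text \<open>The inner loop of \<open>BFS\<close> verbatim; folding it in \<open>BFS_def\<close> lets
  the outer loop use one specification of the scan.\<close>

definition BFS_scan :: com where
  "BFS_scan =
     WHILE Less (Var ''e'') (Get ''off'' (Add (Var ''u'') (Const 1))) DO (
         ''x'' ::= Get ''adj'' (Var ''e'') ;;
         IF Equal (Get ''dist'' (Var ''x'')) (Var ''n'') THEN (
           ''dist''\<langle>Var ''x''\<rangle> ::= Add (Get ''dist'' (Var ''u'')) (Const 1) ;;
           ''queue''\<langle>Var ''tail''\<rangle> ::= Var ''x'' ;;
           ''tail'' ::= Add (Var ''tail'') (Const 1))
         ELSE SKIP ;;
         ''e'' ::= Add (Var ''e'') (Const 1))"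

lemma BFS_scan_vars: "assigned BFS_scan = {''x'', ''tail'', ''e''}"
  "stored BFS_scan = {''dist'', ''queue''}"
  by (auto simp: BFS_scan_def)

context adjacency
begin

definition inp :: "state \<Rightarrow> bool" where
  "inp st \<longleftrightarrow> fst st ''n'' = n \<and> snd st ''off'' = off \<and> snd st ''adj'' = adj"

lemma inp_frame:
  assumes "inp st" and "frame c st st'" and "''n'' \<notin> assigned c"
    and "''off'' \<notin> stored c" and "''adj'' \<notin> stored c"
  shows "inp st'"
  using assms by (simp add: inp_def frame_fst frame_snd)

text \<open>The cells up to \<open>h\<close> are reported unchanged because the outer cost bound
  sums degrees over them, and the frame is silent about \<open>queue\<close>, which is
  written.\<close>

lemma wp_BFS_scan:
  assumes inp: "inp st" and u: "fst st ''u'' = u" "fst st ''e'' = off u" "u < n"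
    and start: "scan_inv v u h (snd st ''dist'') (snd st ''queue'') (fst st ''tail'') {}"
  shows "wp BFS_scan (\<lambda>t' st'. t' \<le> t + 40 * deg u + 10 \<and>
     scan_inv v u h (snd st' ''dist'') (snd st' ''queue'') (fst st' ''tail'') {w. {u, w} \<in> E} \<and>
     (\<forall>i\<le>h. snd st' ''queue'' i = snd st ''queue'' i)) t st"
  unfolding BFS_scan_def
\<comment> \<open>The clock bound has \<open>40 * off u\<close> added on the left to avoid
  subtraction of natural numbers.\<close>
proof (rule wp_While[where I = "\<lambda>t' st'. off u \<le> fst st' ''e'' \<and> fst st' ''e'' \<le> off (Suc u) \<and>
      t' + 40 * off u \<le> t + 40 * fst st' ''e'' \<and>
      scan_inv v u h (snd st' ''dist'') (snd st' ''queue'') (fst st' ''tail'')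
        (adj ` {off u..<fst st' ''e''}) \<and>
      (\<forall>i\<le>h. snd st' ''queue'' i = snd st ''queue'' i)"
      and m = "\<lambda>st'. off (Suc u) - fst st' ''e''"], goal_cases)
  case 1
  then show ?case
    using assms off_mono[of u] by simp
next
  case (2 t' st')
  define D q m e where "D = snd st' ''dist''" and "q = snd st' ''queue''"
    and "m = fst st' ''tail''" and "e = fst st' ''e''"
  have st: "snd st' ''off'' = off" "snd st' ''adj'' = adj" "fst st' ''n'' = n" "fst st' ''u'' = u"
    using 2(2) inp u by (auto simp: inp_def frame_fst frame_snd)
  have e: "off u \<le> e" "e < off (Suc u)"
    using 2 st by (auto simp: e_def)
  then have edge: "{u, adj e} \<in> E"
    using adj_edge u by blast
  have ins: "adj ` {off u..<Suc e} = insert (adj e) (adj ` {off u..<e})"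
    using e by (auto simp: less_Suc_eq)
  have inv: "scan_inv v u h D q m (adj ` {off u..<e})"
    using 2 by (simp add: D_def q_def m_def e_def)
  then have "h < m"
    by (simp add: scan_inv_def)
  with 2 e st show ?case
    using scan_push[OF inv edge] scan_skip[OF inv edge]
    by (auto simp: ins e_def[symmetric] D_def[symmetric] q_def[symmetric] m_def[symmetric])
next
  case (3 t' st')
  have st: "snd st' ''off'' = off" "fst st' ''u'' = u"
    using 3(2) inp u by (auto simp: inp_def frame_fst frame_snd)
  have "fst st' ''e'' = off (Suc u)"
    using 3 st by simp
  then show ?case
    using 3 adj_image[OF u(3)] by (auto simp: deg_def algebra_simps)
qed

text \<open>Each dequeued vertex is charged \<open>40 * deg + 40\<close>. No vertex is queued twice,
  so the degree part totals at most \<open>80 * card E\<close>; the rest is linear in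
  \<open>n\<close>, like the reset of \<open>dist\<close>.\<close>

lemma wp_BFS:
  assumes inp: "inp st" and v: "fst st ''v'' = v" "v < n"
  shows "wp BFS (\<lambda>t' st'. t' \<le> t + 70 * n + 80 * card E + 50 \<and>
     bfs_inv v (snd st' ''dist'') (snd st' ''queue'') (fst st' ''tail'') (fst st' ''tail'')) t st"
  unfolding BFS_def[folded BFS_scan_def] wp_Seq wp_Assign
proof (rule wp_conseq[OF wp_fill[where c = n]], goal_cases)
  case (4 t1 st1)
  have st1: "inp st1" "fst st1 ''v'' = v" "\<forall>w<n. snd st1 ''dist'' w = n"
    "t1 \<le> t + 15 * n + 7"
    using 4 inp v by (auto simp: inp_def frame_fst frame_snd)
  show ?case
    unfolding wp_Assign wp_Store
  proof (rule wp_While[where I = "\<lambda>t' st'. t' \<le> t + 15 * n + 25 +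
        (\<Sum>i<fst st' ''head''. 40 * deg (snd st' ''queue'' i) + 40) \<and>
        bfs_inv v (snd st' ''dist'') (snd st' ''queue'') (fst st' ''head'') (fst st' ''tail'')"
        and m = "\<lambda>st'. n - fst st' ''head''"], goal_cases)
    case 1
    then show ?case
      using st1 v bfs_init[OF v(2) st1(3)] by simp
  next
    case (2 t' st')
    define h u where "h = fst st' ''head''" and "u = snd st' ''queue'' h"
    have inp': "inp st'"
      using st1 by (intro inp_frame[OF _ 2(2)]) (auto simp: BFS_scan_vars inp_def)
    have inv: "bfs_inv v (snd st' ''dist'') (snd st' ''queue'') h (fst st' ''tail'')"
      and hm: "h < fst st' ''tail''"
      using 2 by (simp_all add: h_def)
    then have u: "u < n" and hn: "h < n"
      using queue_inv_reached queue_inv_le unfolding bfs_inv_def u_def by (blast, fastforce)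
    show ?case
      unfolding wp_Seq wp_Assign
    proof (rule wp_conseq[OF wp_BFS_scan[where u = u and v = v and h = h]], goal_cases)
      case (6 t2 st2)
      have hd: "fst st2 ''head'' = Suc h"
        using 6 by (simp add: frame_fst BFS_scan_vars h_def)
      have q: "snd st2 ''queue'' i = snd st' ''queue'' i" if "i \<le> h" for i
        using 6 that by simp
      have "(\<Sum>i<h. 40 * deg (snd st2 ''queue'' i) + 40) = (\<Sum>i<h. 40 * deg (snd st' ''queue'' i) + 40)"
        by (rule sum.cong) (auto simp: q)
      then show ?case
        using 6 2(1) hd hn q[of h] scan_end by (auto simp: h_def[symmetric] u_def[symmetric])
    qed (use inp' u scan_start[OF inv hm] in \<open>auto simp: inp_def h_def[symmetric] u_def[symmetric]\<close>)
  next
    case (3 t' st')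
    define m q where "m = fst st' ''tail''" and "q = snd st' ''queue''"
    have inv: "bfs_inv v (snd st' ''dist'') q m m" and hm: "fst st' ''head'' = m"
      using 3 by (auto simp: m_def q_def bfs_inv_def)
    then have Q: "queue_inv v (snd st' ''dist'') q m"
      by (simp add: bfs_inv_def)
    then have "(\<Sum>i<m. deg (q i)) \<le> 2 * card E"
      using queue_inv_reached[OF Q] by (intro sum_deg_inj) (auto simp: queue_inv_def)
    moreover have "(\<Sum>i<m. 40 * deg (q i) + 40) = 40 * (\<Sum>i<m. deg (q i)) + 40 * m"
      by (simp add: sum.distrib sum_distrib_left)
    moreover have "m \<le> n"
      using queue_inv_le[OF Q] .
    ultimately show ?case
      using 3(1) inv hm by (auto simp: m_def[symmetric] q_def[symmetric])
  qed
qed (use inp in \<open>auto simp: inp_def\<close>)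

end

section \<open>Shortest paths are graded walks\<close>

context adjacency
begin

definition layering :: "nat \<Rightarrow> (nat \<Rightarrow> nat) \<Rightarrow> bool" where
  "layering v D \<longleftrightarrow> v < n \<and> D v = 0 \<and>
     (\<forall>w<n. D w \<noteq> n \<longrightarrow> w \<noteq> v \<longrightarrow> (\<exists>x. {x, w} \<in> E \<and> D x \<noteq> n \<and> D w = Suc (D x))) \<and>
     (\<forall>x w. {x, w} \<in> E \<longrightarrow> D x \<noteq> n \<longrightarrow> D w \<noteq> n \<and> D w \<le> Suc (D x))"

text \<open>With head equal to tail, every reached vertex has been scanned, so the closure condition
  holds for all of them.\<close>

lemma bfs_layering:
  assumes "bfs_inv v D q m m"
  shows "layering v D"
proof -
  have Q: "queue_inv v D q m"
    and closed: "\<And>i w. i < m \<Longrightarrow> {q i, w} \<in> E \<Longrightarrow> D w \<noteq> n \<and> D w \<le> Suc (D (q i))"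
    using assms by (auto simp: bfs_inv_def)
  have q0: "q 0 = v" "D v = 0" "0 < m"
    using Q by (auto simp: queue_inv_def)
  have "\<exists>x. {x, w} \<in> E \<and> D x \<noteq> n \<and> D w = Suc (D x)" if w: "w < n" "D w \<noteq> n" "w \<noteq> v" for w
  proof -
    obtain i where "i < m" "w = q i"
      using queue_inv_index[OF Q w(1,2)] by blast
    moreover have "i \<noteq> 0"
      using calculation q0 w by metis
    ultimately show ?thesis
      using Q by (simp add: queue_inv_def)
  qed
  moreover have "D w \<noteq> n \<and> D w \<le> Suc (D x)" if e: "{x, w} \<in> E" "D x \<noteq> n" for x w
  proof -
    have "x < n"
      using edgeD e(1) by blast
    then show ?thesis
      using queue_inv_index[OF Q _ e(2)] closed e(1) by blast
  qed
  ultimately show ?thesis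
    using queue_inv_reached[OF Q q0(3)] q0 unfolding layering_def by blast
qed

lemma layering_start: "layering v D \<Longrightarrow> v < n \<and> D v = 0"
  and layering_edge: "layering v D \<Longrightarrow> {x, w} \<in> E \<Longrightarrow> D x \<noteq> n \<Longrightarrow> D w \<noteq> n \<and> D w \<le> Suc (D x)"
  and layering_parent: "layering v D \<Longrightarrow> w < n \<Longrightarrow> D w \<noteq> n \<Longrightarrow> w \<noteq> v \<Longrightarrow>
    \<exists>x. {x, w} \<in> E \<and> D x \<noteq> n \<and> D w = Suc (D x)"
  unfolding layering_def by simp_all

text \<open>Parents lead from \<open>w\<close> down to the source; conversely, being labelled
  spreads along every edge. The closure form makes searches from different sources
  comparable.\<close>

lemma layering_reached:
  assumes "layering v D" and "w < n"
  shows "D w \<noteq> n \<longleftrightarrow> (v, w) \<in> {(x, y). {x, y} \<in> E}\<^sup>*"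
proof
  assume "D w \<noteq> n"
  then show "(v, w) \<in> {(x, y). {x, y} \<in> E}\<^sup>*"
    using assms(2)
  proof (induction "D w" arbitrary: w rule: less_induct)
    case less
    show ?case
    proof (cases "w = v")
      case False
      then obtain x where x: "{x, w} \<in> E" "D x \<noteq> n" "D w = Suc (D x)"
        using layering_parent[OF assms(1)] less.prems by blast
      then have "(v, x) \<in> {(x, y). {x, y} \<in> E}\<^sup>*"
        using less.hyps[of x] edgeD by auto
      then show ?thesis
        using x(1) by (simp add: rtrancl.rtrancl_into_rtrancl)
    qed simp
  qed
next
  assume "(v, w) \<in> {(x, y). {x, y} \<in> E}\<^sup>*"
  then show "D w \<noteq> n"
  proof (induction rule: rtrancl_induct)
    case base
    then show ?case
      using layering_start[OF assms(1)] by simp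
  next
    case (step y z)
    then show ?case
      using layering_edge[OF assms(1), of y z] by simp
  qed
qed

text \<open>Edges are undirected, so two vertices reached from \<open>v0\<close> reach each other.
  Thus the one component test serves every later source.\<close>

lemma layering_trans:
  assumes "layering v0 D0" "layering v D" "w < n" "D0 v \<noteq> n" "D0 w \<noteq> n"
  shows "D w \<noteq> n"
proof -
  have "sym {(x, y). {x, y} \<in> E}"
    by (auto simp: sym_def insert_commute)
  moreover have "(v0, v) \<in> {(x, y). {x, y} \<in> E}\<^sup>*" "(v0, w) \<in> {(x, y). {x, y} \<in> E}\<^sup>*"
    using assms layering_reached[OF assms(1)] layering_start[OF assms(2)] by blast+
  ultimately have "(v, w) \<in> {(x, y). {x, y} \<in> E}\<^sup>*"
    by (meson rtrancl_trans sym_rtrancl symD)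
  then show ?thesis
    using layering_reached[OF assms(2,3)] by blast
qed

text \<open>Walks grow at the end because the recursion for the counts looks at the predecessor of
  the last vertex.\<close>

inductive graded :: "nat \<Rightarrow> (nat \<Rightarrow> nat) \<Rightarrow> nat list \<Rightarrow> bool" for v D where
  start: "graded v D [v]"
| step: "graded v D p \<Longrightarrow> {last p, w} \<in> E \<Longrightarrow> D w = Suc (D (last p)) \<Longrightarrow> graded v D (p @ [w])"

text \<open>Labels increase strictly along the walk. The bound of all labels by the last one is the
  strengthening from which the induction obtains distinctness.\<close>

lemma graded_props:
  assumes "graded v D p" and "layering v D"
  shows "p \<noteq> [] \<and> hd p = v \<and> distinct p \<and> set p \<subseteq> {..<n} \<and>
    successively (\<lambda>x y. {x, y} \<in> E) p \<and> length p = Suc (D (last p)) \<and>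
    D (last p) \<noteq> n \<and> (\<forall>x\<in>set p. D x \<le> D (last p))"
  using assms(1)
proof (induction rule: graded.induct)
  case start
  then show ?case
    using layering_start[OF assms(2)] by auto
next
  case (step p w)
  then show ?case
    using layering_edge[OF assms(2) step.hyps(2)] edgeD[OF step.hyps(2)]
    by (auto simp: successively_append_iff)
qed

text \<open>An edge raises the label by at most one, so a walk has more vertices than its last
  label; if it has just one more, every step must climb.\<close>

lemma walk_layer:
  assumes "layering v D" and "p \<noteq> []" and "hd p = v" and "successively (\<lambda>x y. {x, y} \<in> E) p"
  shows "D (last p) \<noteq> n \<and> D (last p) < length p \<and> (length p = Suc (D (last p)) \<longrightarrow> graded v D p)"
  using assms(2-)
proof (induction p rule: rev_induct)
  case (snoc w p)
  show ?case
  proof (cases "p = []")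
    case True
    then show ?thesis
      using snoc.prems layering_start[OF assms(1)] graded.start by auto
  next
    case False
    then have e: "{last p, w} \<in> E" and IH: "D (last p) \<noteq> n \<and> D (last p) < length p \<and>
        (length p = Suc (D (last p)) \<longrightarrow> graded v D p)"
      using snoc by (auto simp: successively_append_iff)
    then show ?thesis
      using layering_edge[OF assms(1) e] graded.step[OF _ e] by fastforce
  qed
qed simp

lemma graded_exists:
  assumes "layering v D" and "w < n" and "D w \<noteq> n"
  shows "\<exists>p. graded v D p \<and> last p = w"
  using assms(2,3)
proof (induction "D w" arbitrary: w rule: less_induct)
  case less
  show ?case
  proof (cases "w = v")
    case True
    then show ?thesis
      using graded.start by (intro exI[of _ "[v]"]) simp
  next
    case False
    then obtain x where x: "{x, w} \<in> E" "D x \<noteq> n" "D w = Suc (D x)"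
      using layering_parent[OF assms(1)] less.prems by blast
    then obtain p where "graded v D p" "last p = x"
      using less.hyps[of x] edgeD by auto
    then show ?thesis
      using graded.step[of v D p w] x by (intro exI[of _ "p @ [w]"]) simp
  qed
qed

text \<open>By \<open>walk_layer\<close>, \<open>Suc (D w)\<close> is a lower bound on the length of
  any walk to \<open>w\<close>. Graded walks attain it, and only they do.\<close>

lemma shortest_path_iff_graded:
  assumes "layering v D"
  shows "shortest_path {..<n} E v w p \<longleftrightarrow> graded v D p \<and> last p = w"
proof
  assume p: "shortest_path {..<n} E v w p"
  then have path: "p \<noteq> []" "hd p = v" "last p = w" "successively (\<lambda>x y. {x, y} \<in> E) p" "w < n"
    using last_in_set[of p] by (auto simp: shortest_path_def is_path_def)
  note W = walk_layer[OF assms path(1,2,4)]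
  then obtain q where q: "graded v D q" "last q = w"
    using graded_exists[OF assms path(5)] path(3) by blast
  then have "is_path {..<n} E v w q" "length q = Suc (D w)"
    using graded_props[OF q(1) assms] by (auto simp: is_path_def)
  then have "length p \<le> Suc (D w)"
    using p by (auto simp: shortest_path_def)
  then show "graded v D p \<and> last p = w"
    using W path(3) by auto
next
  assume p: "graded v D p \<and> last p = w"
  have "length p \<le> length q" if "is_path {..<n} E v w q" for q
    using walk_layer[OF assms, of q] graded_props[OF _ assms, of p] p that
    by (auto simp: is_path_def)
  then show "shortest_path {..<n} E v w p"
    using graded_props[OF _ assms, of p] p by (auto simp: shortest_path_def is_path_def)
qed

text \<open>A minimum over predecessors, split in two: the inequality bounds every graded walk from
  below, the equality builds an optimal one.\<close>

definition counts :: "nat set \<Rightarrow> nat \<Rightarrow> (nat \<Rightarrow> nat) \<Rightarrow> (nat \<Rightarrow> nat) \<Rightarrow> bool" where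
  "counts S v D C \<longleftrightarrow> C v = 0 \<and> (\<forall>w<n. D w \<noteq> n \<longrightarrow> w \<noteq> v \<longrightarrow>
     (\<forall>x. {x, w} \<in> E \<longrightarrow> D x \<noteq> n \<longrightarrow> D w = Suc (D x) \<longrightarrow> C w \<le> C x + of_bool (w \<in> S)) \<and>
     (\<exists>x. {x, w} \<in> E \<and> D x \<noteq> n \<and> D w = Suc (D x) \<and> C w = C x + of_bool (w \<in> S)))"

lemma card_snoc:
  assumes "w \<notin> set p" and "w \<noteq> v"
  shows "card (set (p @ [w]) \<inter> (S - {v})) = card (set p \<inter> (S - {v})) + of_bool (w \<in> S)"
  using assms by (simp add: Int_insert_left)

lemma counts_le:
  assumes "layering v D" and "counts S v D C" and "graded v D p"
  shows "C (last p) \<le> card (set p \<inter> (S - {v}))"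
  using assms(3)
proof (induction rule: graded.induct)
  case start
  then show ?case
    using assms(2) by (simp add: counts_def)
next
  case (step p w)
  have P: "D (last p) \<noteq> n" "w \<notin> set p" "w \<noteq> v" "w < n"
    using graded_props[OF step.hyps(1) assms(1)] edgeD[OF step.hyps(2)] step.hyps(3)
      layering_start[OF assms(1)] by auto
  then have "D w \<noteq> n"
    using layering_edge[OF assms(1) step.hyps(2)] by blast
  then have "C w \<le> C (last p) + of_bool (w \<in> S)"
    using assms(2) P step.hyps(2,3) unfolding counts_def by blast
  then show ?case
    using step.IH unfolding card_snoc[OF P(2,3)] by simp
qed

lemma counts_attained:
  assumes "layering v D" and "counts S v D C" and "w < n" and "D w \<noteq> n"
  shows "\<exists>p. graded v D p \<and> last p = w \<and> card (set p \<inter> (S - {v})) = C w"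
  using assms(3,4)
proof (induction "D w" arbitrary: w rule: less_induct)
  case less
  show ?case
  proof (cases "w = v")
    case True
    then show ?thesis
      using graded.start assms(2) by (intro exI[of _ "[v]"]) (simp add: counts_def)
  next
    case False
    then obtain x where x: "{x, w} \<in> E" "D x \<noteq> n" "D w = Suc (D x)" "C w = C x + of_bool (w \<in> S)"
      using assms(2) less.prems unfolding counts_def by blast
    then obtain p where p: "graded v D p" "last p = x" "card (set p \<inter> (S - {v})) = C x"
      using less.hyps[of x] edgeD by auto
    have "w \<notin> set p"
      using graded_props[OF p(1) assms(1)] x(3) p(2) by auto
    then show ?thesis
      using graded.step[OF p(1), of w] p x card_snoc[OF _ False, of p S]
      by (intro exI[of _ "p @ [w]"]) simp
  qed
qed

lemma visible_iff_counts:
  assumes "layering v D" and "counts S v D C" and "w \<in> S" and "w < n" and "w \<noteq> v"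
  shows "visible {..<n} E S k v w \<longleftrightarrow> D w \<noteq> n \<and> C w \<le> Suc k"
proof -
  have card: "card (set p \<inter> (S - {v})) = Suc (card ((set p - {v, w}) \<inter> S))"
    if "graded v D p" "last p = w" for p
  proof -
    have "w \<in> set p"
      using graded_props[OF that(1) assms(1)] that(2) last_in_set by blast
    then have "set p \<inter> (S - {v}) = insert w ((set p - {v, w}) \<inter> S)"
      using assms(3,5) by blast
    then show ?thesis
      by (simp add: card_insert_if)
  qed
  show ?thesis
  proof
    assume "visible {..<n} E S k v w"
    then obtain p where p: "graded v D p" "last p = w" "card ((set p - {v, w}) \<inter> S) \<le> k"
      unfolding visible_def shortest_path_iff_graded[OF assms(1)] by blast
    then show "D w \<noteq> n \<and> C w \<le> Suc k"
      using graded_props[OF p(1) assms(1)] counts_le[OF assms(1,2) p(1)] card[OF p(1,2)] by auto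
  next
    assume "D w \<noteq> n \<and> C w \<le> Suc k"
    then obtain p where "graded v D p" "last p = w" "card (set p \<inter> (S - {v})) \<le> Suc k"
      using counts_attained[OF assms(1,2,4)] by auto
    then show "visible {..<n} E S k v w"
      unfolding visible_def shortest_path_iff_graded[OF assms(1)] using card by auto
  qed
qed

lemma not_visible_unreached:
  assumes "layering v D" and "D w = n"
  shows "\<not> visible {..<n} E S k v w"
  using graded_props[OF _ assms(1)] assms(2)
  unfolding visible_def shortest_path_iff_graded[OF assms(1)] by blast

end

section \<open>Counting and checking\<close>

definition count_scan :: com where
  "count_scan =
       WHILE Less (Var ''e'') (Get ''off'' (Add (Var ''w'') (Const 1))) DO (
         ''x'' ::= Get ''adj'' (Var ''e'') ;;
         IF Conj (Equal (Add (Get ''dist'' (Var ''x'')) (Const 1)) (Get ''dist'' (Var ''w'')))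
                 (Less (Get ''cnt'' (Var ''x'')) (Var ''best''))
         THEN ''best'' ::= Get ''cnt'' (Var ''x'') ELSE SKIP ;;
         ''e'' ::= Add (Var ''e'') (Const 1))"

lemma count_scan_vars: "assigned count_scan = {''x'', ''best'', ''e''}" "stored count_scan = {}"
  by (auto simp: count_scan_def)

lemma BFS_vars:
  "assigned BFS = {''a'', ''head'', ''tail'', ''u'', ''e'', ''x''}" "stored BFS = {''dist'', ''queue''}"
  by (auto simp: BFS_def)

lemma count_layers_vars:
  "assigned count_layers = {''h'', ''w'', ''best'', ''e'', ''x''}" "stored count_layers = {''cnt''}"
  by (auto simp: count_layers_def)

lemma check_vars:
  "assigned check_counts = {''j'', ''q'', ''ok''}" "stored check_counts = {}"
  "assigned check_component = {''v'', ''j'', ''ok''} \<union> assigned BFS"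
  "stored check_component = stored BFS"
  "assigned mark_S = {''a'', ''j''}" "stored mark_S = {''inS''}"
  by (auto simp: check_counts_def check_component_def mark_S_def)

lemma wp_check_counts:
  "wp check_counts (\<lambda>t' st'. t' \<le> t + 40 * fst st ''s'' + 10 \<and>
     fst st' ''ok'' = (if \<exists>j<fst st ''s''. snd st ''S'' j \<noteq> fst st ''v'' \<and>
       Suc (fst st ''k'') < snd st ''cnt'' (snd st ''S'' j) then 0 else fst st ''ok'')) t st"
  unfolding check_counts_def wp_Seq wp_Assign
proof (rule wp_While[where I = "\<lambda>t' st'. t' \<le> t + 2 + 40 * fst st' ''j'' \<and> fst st' ''j'' \<le> fst st ''s'' \<and>
     fst st' ''ok'' = (if \<exists>j<fst st' ''j''. snd st ''S'' j \<noteq> fst st ''v'' \<and>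
       Suc (fst st ''k'') < snd st ''cnt'' (snd st ''S'' j) then 0 else fst st ''ok'')"
     and m = "\<lambda>st'. fst st ''s'' - fst st' ''j''"], goal_cases)
  case 1
  then show ?case
    by simp
next
  case (2 t' st')
  have "fst st' ''s'' = fst st ''s''" "fst st' ''v'' = fst st ''v''" "fst st' ''k'' = fst st ''k''"
    "snd st' ''S'' = snd st ''S''" "snd st' ''cnt'' = snd st ''cnt''"
    using 2(2) by (auto simp: frame_fst frame_snd)
  then show ?case
    using 2(1,3) by (auto simp: less_Suc_eq)
next
  case (3 t' st')
  have "fst st' ''s'' = fst st ''s''"
    using 3(2) by (auto simp: frame_fst frame_snd)
  then show ?case
    using 3(1,3) by (auto simp: le_antisym not_less)
qed

context adjacency
begin

text \<open>The alternative \<open>best = n\<close> stays open because the scan alone cannot exclude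
  that no neighbour improves the initial value; the bounds on earlier counts exclude it
  later.\<close>

lemma wp_count_scan:
  assumes inp: "inp st" and w: "fst st ''w'' = w" "fst st ''e'' = off w" "fst st ''best'' = n" "w < n"
  shows "wp count_scan (\<lambda>t' st'. t' \<le> t + 40 * deg w + 10 \<and>
     (\<forall>x. {w, x} \<in> E \<longrightarrow> Suc (snd st ''dist'' x) = snd st ''dist'' w \<longrightarrow> fst st' ''best'' \<le> snd st ''cnt'' x) \<and>
     (fst st' ''best'' = n \<or> (\<exists>x. {w, x} \<in> E \<and> Suc (snd st ''dist'' x) = snd st ''dist'' w \<and>
        fst st' ''best'' = snd st ''cnt'' x))) t st"
  unfolding count_scan_def
proof (rule wp_While[where I = "\<lambda>t' st'. off w \<le> fst st' ''e'' \<and> fst st' ''e'' \<le> off (Suc w) \<and>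
      t' + 40 * off w \<le> t + 40 * fst st' ''e'' \<and>
      (\<forall>x\<in>adj ` {off w..<fst st' ''e''}. Suc (snd st ''dist'' x) = snd st ''dist'' w \<longrightarrow>
         fst st' ''best'' \<le> snd st ''cnt'' x) \<and>
      (fst st' ''best'' = n \<or> (\<exists>x. {w, x} \<in> E \<and> Suc (snd st ''dist'' x) = snd st ''dist'' w \<and>
        fst st' ''best'' = snd st ''cnt'' x))"
      and m = "\<lambda>st'. off (Suc w) - fst st' ''e''"], goal_cases)
  case 1
  then show ?case
    using assms off_mono[of w] by simp
next
  case (2 t' st')
  have st: "snd st' ''off'' = off" "snd st' ''adj'' = adj" "fst st' ''w'' = w"
    "snd st' ''dist'' = snd st ''dist''" "snd st' ''cnt'' = snd st ''cnt''"
    using 2(2) inp w by (auto simp: inp_def frame_fst frame_snd)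
  define e where "e = fst st' ''e''"
  have e: "off w \<le> e" "e < off (Suc w)"
    using 2 st by (auto simp: e_def)
  then have "{w, adj e} \<in> E"
    using adj_edge w by blast
  then show ?case
    using 2(1) e st by (auto simp: e_def[symmetric] less_Suc_eq)
next
  case (3 t' st')
  have st: "snd st' ''off'' = off" "fst st' ''w'' = w"
    using 3(2) inp w by (auto simp: inp_def frame_fst frame_snd)
  have "fst st' ''e'' = off (Suc w)"
    using 3 st by simp
  then show ?case
    using 3 adj_image[OF w(4)] by (auto simp: deg_def algebra_simps)
qed

text \<open>The bound \<open>C (q i) \<le> i\<close> keeps the counts below the initial value \<open>n\<close> of the running minimum.\<close>

definition cnt_inv ::
  "nat set \<Rightarrow> nat \<Rightarrow> (nat \<Rightarrow> nat) \<Rightarrow> (nat \<Rightarrow> nat) \<Rightarrow> nat \<Rightarrow> (nat \<Rightarrow> nat) \<Rightarrow> bool" where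
  "cnt_inv S v D q h C \<longleftrightarrow> C v = 0 \<and> (\<forall>i<h. C (q i) \<le> i) \<and> (\<forall>i. 0 < i \<longrightarrow> i < h \<longrightarrow>
     (\<forall>x. {x, q i} \<in> E \<longrightarrow> D x \<noteq> n \<longrightarrow> D (q i) = Suc (D x) \<longrightarrow> C (q i) \<le> C x + of_bool (q i \<in> S)) \<and>
     (\<exists>x. {x, q i} \<in> E \<and> D x \<noteq> n \<and> D (q i) = Suc (D x) \<and> C (q i) = C x + of_bool (q i \<in> S)))"

lemma cnt_inv_start: "queue_inv v D q m \<Longrightarrow> cnt_inv S v D q 1 (C(v := 0))"
  by (auto simp: cnt_inv_def queue_inv_def)

lemma cnt_inv_end:
  assumes "queue_inv v D q m" and "cnt_inv S v D q m C"
  shows "counts S v D C"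
  unfolding counts_def
proof (intro conjI allI impI, goal_cases)
  case 1
  then show ?case
    using assms(2) by (simp add: cnt_inv_def)
next
  case (2 w x)
  then obtain i where "i < m" "w = q i"
    using queue_inv_index[OF assms(1)] by blast
  moreover from this have "0 < i"
    using 2 assms(1) by (cases i) (auto simp: queue_inv_def)
  ultimately show ?case
    using 2 assms(2) unfolding cnt_inv_def by blast
next
  case (3 w)
  then obtain i where "i < m" "w = q i"
    using queue_inv_index[OF assms(1)] by blast
  moreover from this have "0 < i"
    using 3 assms(1) by (cases i) (auto simp: queue_inv_def)
  ultimately show ?case
    using assms(2) unfolding cnt_inv_def by blast
qed

text \<open>A predecessor has a smaller label, hence an earlier cell of the sorted queue. So its
  count is final when \<open>w\<close> is processed, and writing the count of \<open>w\<close>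
  leaves the earlier equations intact.\<close>

lemma cnt_inv_step:
  assumes Q: "queue_inv v D q m" and C: "cnt_inv S v D q h C" and h: "0 < h" "h < m" and w: "w = q h"
    and le: "\<And>x. {w, x} \<in> E \<Longrightarrow> Suc (D x) = D w \<Longrightarrow> best \<le> C x"
    and att: "best = n \<or> (\<exists>x. {w, x} \<in> E \<and> Suc (D x) = D w \<and> best = C x)"
  shows "cnt_inv S v D q (Suc h) (C(w := best + of_bool (w \<in> S)))"
proof -
  let ?C = "C(w := best + of_bool (w \<in> S))"
  have mono: "\<And>i j. i \<le> j \<Longrightarrow> j < m \<Longrightarrow> D (q i) \<le> D (q j)" and inj: "inj_on q {..<m}"
    and q0: "q 0 = v" and Di: "\<And>i. i < m \<Longrightarrow> D (q i) \<le> i"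
    using Q by (auto simp: queue_inv_def)
  have mn: "m \<le> n"
    by (rule queue_inv_le[OF Q])
  have neq: "q i \<noteq> w" if "i < h" for i
    using inj_onD[OF inj, of i h] w h that by auto
  have earlier: "\<exists>j<i. x = q j" if x: "{x, q i} \<in> E" "D x \<noteq> n" "D (q i) = Suc (D x)" and i: "i < m" for x i
  proof -
    obtain j where "j < m" "x = q j"
      using queue_inv_index[OF Q _ x(2)] edgeD[OF x(1)] by blast
    moreover have "\<not> i \<le> j"
      using mono[of i j] calculation x(3) by auto
    ultimately show ?thesis
      by (metis not_le)
  qed
  have Ci: "C (q i) \<le> i" if "i < h" for i
    using C that by (simp add: cnt_inv_def)
  \<comment> \<open>The parent of \<open>w\<close> occupies an earlier cell and has a count below
    \<open>n\<close>; so \<open>best < n\<close>, and the value is attained by a neighbour.\<close>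
  obtain x where x: "{x, w} \<in> E" "D x \<noteq> n" "D w = Suc (D x)" "best = C x"
  proof -
    obtain y where y: "{y, w} \<in> E" "D y \<noteq> n" "D w = Suc (D y)"
      using Q h w unfolding queue_inv_def by blast
    then obtain j where "j < h" "y = q j"
      using earlier h w by blast
    then have "best < n"
      using le[of y] y Ci[of j] h mn by (simp add: insert_commute)
    then obtain x where "{x, w} \<in> E" "D w = Suc (D x)" "best = C x"
      using att by (metis insert_commute less_irrefl)
    \<comment> \<open>Otherwise \<open>D w\<close> would be \<open>Suc n\<close>, against
      \<open>D (q h) <= h < n\<close>.\<close>
    moreover have "D x \<noteq> n"
      using calculation Di[OF h(2)] w h mn by auto
    ultimately show ?thesis
      using that by blast
  qed
  then obtain j where j: "j < h" "x = q j"
    using earlier h w by blast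
  \<comment> \<open>The predecessor sits in a cell \<open>j < h\<close>, so the new count is at most
    \<open>j + 1 <= h\<close>.\<close>
  have "?C (q i) \<le> i" if "i < Suc h" for i
  proof (cases "i = h")
    case True
    then show ?thesis
      using Ci[OF j(1)] j x(4) w by simp
  next
    case False
    then show ?thesis
      using Ci[of i] neq[of i] that by simp
  qed
  moreover have "?C v = 0"
    using C neq[of 0] h q0 by (auto simp: cnt_inv_def)
  moreover have "(\<forall>x. {x, q i} \<in> E \<longrightarrow> D x \<noteq> n \<longrightarrow> D (q i) = Suc (D x) \<longrightarrow>
        ?C (q i) \<le> ?C x + of_bool (q i \<in> S)) \<and>
     (\<exists>x. {x, q i} \<in> E \<and> D x \<noteq> n \<and> D (q i) = Suc (D x) \<and> ?C (q i) = ?C x + of_bool (q i \<in> S))"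
    if i: "0 < i" "i < Suc h" for i
  proof (cases "i = h")
    case True
    have "?C (q h) \<le> ?C y + of_bool (q h \<in> S)"
      if y: "{y, q h} \<in> E" "D (q h) = Suc (D y)" for y
      using le[of y] y w edgeD[OF y(1)] by (auto simp: insert_commute)
    moreover have "?C (q h) = ?C x + of_bool (q h \<in> S)"
      using x w j neq by auto
    ultimately show ?thesis
      using True x w by blast
  next
    case False
    then have ih: "i < h"
      using i by simp
    have same: "?C y = C y" if "{y, q i} \<in> E" "D y \<noteq> n" "D (q i) = Suc (D y)" for y
      using earlier[OF that] ih h neq by fastforce
    moreover have "?C (q i) = C (q i)"
      using neq[OF ih] by simp
    moreover have "(\<forall>x. {x, q i} \<in> E \<longrightarrow> D x \<noteq> n \<longrightarrow> D (q i) = Suc (D x) \<longrightarrow>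
        C (q i) \<le> C x + of_bool (q i \<in> S)) \<and>
     (\<exists>x. {x, q i} \<in> E \<and> D x \<noteq> n \<and> D (q i) = Suc (D x) \<and> C (q i) = C x + of_bool (q i \<in> S))"
      using C i(1) ih unfolding cnt_inv_def by blast
    ultimately show ?thesis
      by metis
  qed
  ultimately show ?thesis
    unfolding cnt_inv_def by blast
qed

lemma wp_count_layers:
  assumes inp: "inp st" and v: "fst st ''v'' = v"
    and Q: "queue_inv v (snd st ''dist'') (snd st ''queue'') (fst st ''tail'')"
    and inS: "\<And>w. w < n \<Longrightarrow> snd st ''inS'' w = of_bool (w \<in> S)"
  shows "wp count_layers (\<lambda>t' st'. t' \<le> t + 50 * n + 80 * card E + 30 \<and>
     counts S v (snd st ''dist'') (snd st' ''cnt'')) t st"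
  unfolding count_layers_def[folded count_scan_def] wp_Seq wp_Assign wp_Store
\<comment> \<open>The sum also charges cell \<open>0\<close>, the source, which is not scanned; this
  slack makes it a sum over the whole queue in the end, ready for
  \<open>sum_deg_inj\<close>.\<close>
proof (rule wp_While[where I = "\<lambda>t' st'. 0 < fst st' ''h'' \<and> fst st' ''h'' \<le> fst st ''tail'' \<and>
      t' \<le> t + 10 + (\<Sum>i<fst st' ''h''. 40 * deg (snd st ''queue'' i) + 50) \<and>
      cnt_inv S v (snd st ''dist'') (snd st ''queue'') (fst st' ''h'') (snd st' ''cnt'')"
      and m = "\<lambda>st'. fst st ''tail'' - fst st' ''h''"], goal_cases)
  case 1
  have "0 < fst st ''tail''"
    using Q by (simp add: queue_inv_def)
  then show ?case
    using cnt_inv_start[OF Q] v by simp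
next
  case (2 t' st')
  define D q m h w where "D = snd st ''dist''" and "q = snd st ''queue''" and "m = fst st ''tail''"
    and "h = fst st' ''h''" and "w = q h"
  have st': "inp st'" "snd st' ''dist'' = D" "snd st' ''queue'' = q" "fst st' ''tail'' = m"
      "snd st' ''inS'' = snd st ''inS''"
    using 2(2) inp by (auto simp: inp_def D_def q_def m_def frame_fst frame_snd count_scan_vars)
  have hm: "0 < h" "h < m" and C: "cnt_inv S v D q h (snd st' ''cnt'')"
    using 2 st' by (auto simp: D_def q_def m_def h_def)
  have Q': "queue_inv v D q m"
    using Q by (simp add: D_def q_def m_def)
  have wn: "w < n"
    using queue_inv_reached[OF Q' hm(2)] by (simp add: w_def)
  show ?case
    unfolding wp_Seq wp_Assign
  proof (rule wp_conseq[OF wp_count_scan[where w = w]], goal_cases)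
    case (6 t2 st2)
    have st2: "fst st2 ''h'' = h" "fst st2 ''w'' = w" "snd st2 ''cnt'' = snd st' ''cnt''"
      "snd st2 ''inS'' w = of_bool (w \<in> S)"
      using 6 st' inS[OF wn] by (auto simp: frame_fst frame_snd count_scan_vars h_def w_def)
    have "cnt_inv S v D q (Suc h) ((snd st' ''cnt'')(w := fst st2 ''best'' + of_bool (w \<in> S)))"
      using 6 st' by (intro cnt_inv_step[OF Q' C hm w_def]) auto
    then show ?case
      using 6 2(1) st' st2 hm
      by (auto simp: h_def[symmetric] D_def[symmetric] q_def[symmetric] m_def[symmetric] w_def[symmetric])
  qed (use st' wn in \<open>auto simp: inp_def h_def[symmetric] w_def[symmetric]\<close>)
next
  case (3 t' st')
  have "fst st' ''tail'' = fst st ''tail''"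
    using 3(2) by (auto simp: frame_fst count_scan_vars)
  then have h: "fst st' ''h'' = fst st ''tail''"
    using 3 by simp
  have "(\<Sum>i<fst st ''tail''. deg (snd st ''queue'' i)) \<le> 2 * card E"
    using queue_inv_reached[OF Q] Q by (intro sum_deg_inj) (auto simp: queue_inv_def)
  moreover have "(\<Sum>i<fst st ''tail''. 40 * deg (snd st ''queue'' i) + 50) =
      40 * (\<Sum>i<fst st ''tail''. deg (snd st ''queue'' i)) + 50 * fst st ''tail''"
    by (simp add: sum.distrib sum_distrib_left)
  ultimately show ?case
    using 3(1) queue_inv_le[OF Q] cnt_inv_end[OF Q] by (simp add: h)
qed

section \<open>The phases of the algorithm and their assembly\<close>

definition input :: "(nat \<Rightarrow> nat) \<Rightarrow> nat \<Rightarrow> nat \<Rightarrow> state \<Rightarrow> bool" where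
  "input A s k st \<longleftrightarrow> inp st \<and> fst st ''s'' = s \<and> fst st ''k'' = k \<and> snd st ''S'' = A"

text \<open>\<open>D\<close> is hidden behind an existential because later searches overwrite
  \<open>dist\<close>; the labelling itself is still needed to reason about them.\<close>

lemma wp_check_component:
  assumes inp: "input A s k st" and A: "A 0 < n"
  shows "wp check_component (\<lambda>t' st'. t' \<le> t + 70 * n + 80 * card E + 40 * s + 80 \<and>
     (\<exists>D. layering (A 0) D \<and>
       fst st' ''ok'' = (if \<exists>w\<in>A ` {..<s}. D w = n then 0 else fst st ''ok''))) t st"
  unfolding check_component_def wp_Seq wp_Assign
proof (rule wp_conseq[OF wp_BFS[where v = "A 0"]], goal_cases)
  case (4 t1 st1)
  define D where "D = snd st1 ''dist''"
  have L: "layering (A 0) D"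
    using 4(1) bfs_layering by (auto simp: D_def)
  have st1: "input A s k st1" "fst st1 ''ok'' = fst st ''ok''"
    using 4(2) inp by (auto simp: input_def inp_def frame_fst frame_snd BFS_vars)
  show ?case
    unfolding wp_Assign
  proof (rule wp_While[where I = "\<lambda>t' st'. t' \<le> t1 + 2 + 40 * fst st' ''j'' \<and> fst st' ''j'' \<le> s \<and>
     fst st' ''ok'' = (if \<exists>w\<in>A ` {..<fst st' ''j''}. D w = n then 0 else fst st ''ok'')"
     and m = "\<lambda>st'. s - fst st' ''j''"], goal_cases)
    case 1
    then show ?case
      using st1 by simp
  next
    case (2 t' st')
    have "input A s k st'" "snd st' ''dist'' = D"
      using 2(2) st1 by (auto simp: input_def inp_def D_def frame_fst frame_snd)
    then show ?case
      using 2(1,3) by (auto simp: input_def inp_def lessThan_Suc)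
  next
    case (3 t' st')
    have "input A s k st'"
      using 3(2) st1 by (auto simp: input_def inp_def frame_fst frame_snd)
    then have "fst st' ''j'' = s"
      using 3 by (auto simp: input_def)
    then show ?case
      using 3 4(1) L by (intro conjI exI[of _ D]) auto
  qed
qed (use inp A in \<open>auto simp: input_def inp_def\<close>)

lemma wp_mark_S:
  assumes inp: "input A s k st" and A: "A ` {..<s} \<subseteq> {..<n}"
  shows "wp mark_S (\<lambda>t' st'. t' \<le> t + 15 * n + 20 * s + 30 \<and>
     (\<forall>w<n. snd st' ''inS'' w = of_bool (w \<in> A ` {..<s}))) t st"
  unfolding mark_S_def wp_Seq wp_Assign
proof (rule wp_conseq[OF wp_fill[where c = 0]], goal_cases)
  case (4 t1 st1)
  have st1: "input A s k st1"
    using 4(2) inp by (auto simp: input_def inp_def frame_fst frame_snd)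
  show ?case
    unfolding wp_Assign
  proof (rule wp_While[where I = "\<lambda>t' st'. t' \<le> t1 + 2 + 20 * fst st' ''j'' \<and> fst st' ''j'' \<le> s \<and>
     (\<forall>w<n. snd st' ''inS'' w = of_bool (w \<in> A ` {..<fst st' ''j''}))"
     and m = "\<lambda>st'. s - fst st' ''j''"], goal_cases)
    case 1
    then show ?case
      using 4(1) inp by (simp add: input_def inp_def)
  next
    case (2 t' st')
    have "input A s k st'"
      using 2(2) st1 by (auto simp: input_def inp_def frame_fst frame_snd)
    then show ?case
      using 2(1,3) by (auto simp: input_def inp_def lessThan_Suc)
  next
    case (3 t' st')
    have "input A s k st'"
      using 3(2) st1 by (auto simp: input_def inp_def frame_fst frame_snd)
    then have "fst st' ''j'' = s"
      using 3 by (auto simp: input_def)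
    then show ?case
      using 3 4(1) inp by (auto simp: input_def inp_def)
  qed
qed simp_all

lemma wp_MkV:
  assumes inp: "input A (card S) k st" and A: "bij_betw A {..<card S} S" and S: "S \<subseteq> {..<n}"
  shows "wp MkV (\<lambda>t' st'. t' \<le> t + 1000 * max 1 (card S * (n + card E) + (card S)\<^sup>2) \<and>
     (accepts st' \<longleftrightarrow> mutual_visible {..<n} E k S)) t st"
proof (cases "card S = 0")
  \<comment> \<open>Without members the program takes constantly many steps, which
    \<open>max 1\<close> in the bound pays for.\<close>
  case True
  then have "S = {}"
    using S finite_subset[of S "{..<n}"] by simp
  then show ?thesis
    using inp by (simp add: MkV_def input_def accepts_def mutual_visible_def)
next
  case False
  define s where "s = card S"
  have SA: "S = A ` {..<s}" and s: "0 < s"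
    using A False by (auto simp: bij_betw_def s_def)
  have An: "A i < n" if "i < s" for i
    using S SA that by auto
  have st0: "input A s k st"
    using inp by (simp add: s_def)
  \<comment> \<open>The first group pays for the component test and the marking; the factor of
    \<open>s\<close> pays for one round of search, counting and checking.\<close>
  have "wp MkV (\<lambda>t' st'. t' \<le> t + 200 + (100 * n + 80 * card E + 60 * s) +
          s * (150 * n + 200 * card E + 50 * s + 200) \<and>
     (accepts st' \<longleftrightarrow> mutual_visible {..<n} E k S)) t st"
    unfolding MkV_def wp_Seq wp_Assign wp_If
  proof (rule if_split[THEN iffD2], intro conjI impI, rule wp_conseq[OF wp_check_component[where A = A and s = s and k = k]], goal_cases)
    case (3 t1 st1)
    have t1: "t1 \<le> t + 70 * n + 80 * card E + 40 * s + 90"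
      using 3(2) by simp
    obtain D0 where D0: "layering (A 0) D0"
      and ok1: "fst st1 ''ok'' = (if \<exists>w\<in>S. D0 w = n then 0 else 1)"
      using 3(2) by (auto simp: SA)
    have st1: "input A s k st1"
      using 3(3) st0 by (auto simp: input_def inp_def frame_fst frame_snd check_vars BFS_vars)
    \<comment> \<open>The first member cannot see an unreached \<open>w\<close>, so a failed
      component test rejects correctly.\<close>
    have ok1_mv: "\<not> mutual_visible {..<n} E k S" if "fst st1 ''ok'' \<noteq> 1"
    proof -
      obtain w where w: "w \<in> S" "D0 w = n"
        using \<open>fst st1 ''ok'' \<noteq> 1\<close> ok1 by (auto split: if_splits)
      moreover have "A 0 \<noteq> w"
        using w(2) layering_start[OF D0] by auto
      moreover have "A 0 \<in> S"
        using s by (simp add: SA)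
      moreover have "\<not> visible {..<n} E S k (A 0) w"
        by (rule not_visible_unreached[OF D0 w(2)])
      ultimately show ?thesis
        by (auto simp: mutual_visible_def)
    qed
    show ?case
    proof (rule wp_conseq[OF wp_mark_S[OF st1]], goal_cases)
      case (2 t2 st2)
      have t2: "t2 \<le> t1 + 15 * n + 20 * s + 30"
        using 2(1) by blast
      have st2: "input A s k st2" "fst st2 ''ok'' = fst st1 ''ok''"
        "\<And>w. w < n \<Longrightarrow> snd st2 ''inS'' w = of_bool (w \<in> S)"
        using 2 st1 by (auto simp: input_def inp_def frame_fst frame_snd check_vars SA)
      show ?case
        unfolding wp_Assign
      \<comment> \<open>A cleared flag stops the loop, even before its first round. Hence the case
        split: either all processed sources passed, or the set is known to fail.\<close>
      proof (rule wp_While[where I = "\<lambda>t' st'. fst st' ''i'' \<le> s \<and>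
            t' \<le> t2 + 2 + fst st' ''i'' * (150 * n + 200 * card E + 50 * s + 200) \<and>
            (if fst st' ''ok'' = 1 then (\<forall>w\<in>S. D0 w \<noteq> n) \<and>
               (\<forall>i<fst st' ''i''. \<forall>w\<in>S. A i \<noteq> w \<longrightarrow> visible {..<n} E S k (A i) w)
             else \<not> mutual_visible {..<n} E k S)"
            and m = "\<lambda>st'. s - fst st' ''i''"], goal_cases)
        case 1
        then show ?case
          using st2 ok1 ok1_mv by (auto split: if_splits)
      next
        case (2 t' st')
        define i v where "i = fst st' ''i''" and "v = A i"
        have st': "input A s k st'" "\<And>w. w < n \<Longrightarrow> snd st' ''inS'' w = of_bool (w \<in> S)"
          using 2(2) st2(1,3) by (auto simp: input_def inp_def frame_fst frame_snd check_vars
              BFS_vars count_layers_vars)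
        have i: "i < s" "fst st' ''ok'' = 1" and reach: "\<And>w. w \<in> S \<Longrightarrow> D0 w \<noteq> n"
          and vis: "\<And>j w. j < i \<Longrightarrow> w \<in> S \<Longrightarrow> A j \<noteq> w \<Longrightarrow> visible {..<n} E S k (A j) w"
          and t': "t' \<le> t2 + 2 + i * (150 * n + 200 * card E + 50 * s + 200)"
          using 2(1,3) st'(1) by (auto simp: i_def input_def)
        have v: "v < n" "v \<in> S"
          using An i by (auto simp: v_def SA)
        show ?case
          unfolding wp_Seq wp_Assign
        proof (rule wp_conseq[OF wp_BFS[where v = v]], goal_cases)
          case (4 t3 st3)
          have st3: "input A s k st3" "fst st3 ''v'' = v" "fst st3 ''i'' = i" "fst st3 ''ok'' = 1"
            "\<And>w. w < n \<Longrightarrow> snd st3 ''inS'' w = of_bool (w \<in> S)"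
            using 4(2) st' i
            by (auto simp: input_def inp_def frame_fst frame_snd BFS_vars i_def[symmetric] v_def)
          define D where "D = snd st3 ''dist''"
          have Q: "queue_inv v (snd st3 ''dist'') (snd st3 ''queue'') (fst st3 ''tail'')"
            and L: "layering v D"
            using 4(1) bfs_layering by (auto simp: bfs_inv_def D_def)
          have inp3: "inp st3"
            using st3(1) by (simp add: input_def)
          show ?case
          proof (rule wp_conseq[OF wp_count_layers[OF inp3 st3(2) Q st3(5)]], assumption, goal_cases)
            case (1 t4 st4)
            define C where "C = snd st4 ''cnt''"
            have t4: "t4 \<le> t3 + 50 * n + 80 * card E + 30"
              using 1(1) by blast
            have C: "counts S v D C"
              using 1(1) by (simp add: D_def C_def)
            have st4: "input A s k st4" "fst st4 ''v'' = v" "fst st4 ''i'' = i" "fst st4 ''ok'' = 1"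
              using 1(2) st3 by (auto simp: input_def inp_def frame_fst frame_snd count_layers_vars)
            \<comment> \<open>\<open>check_counts\<close> does not consult \<open>dist\<close>;
              reachability of \<open>w\<close> from \<open>v\<close> comes from the labelling
              \<open>D0\<close> of the first member.\<close>
            have visv: "visible {..<n} E S k v w \<longleftrightarrow> C w \<le> Suc k" if "w \<in> S" "w \<noteq> v" for w
            proof -
              have w: "w < n"
                using that(1) S by auto
              then have "D w \<noteq> n"
                by (rule layering_trans[OF D0 L _ reach[OF v(2)] reach[OF that(1)]])
              then show ?thesis
                using visible_iff_counts[OF L C that(1) w that(2)] by simp
            qed
            show ?case
            proof (rule wp_conseq[OF wp_check_counts], goal_cases)
              case (1 t5 st5)
              have st5: "fst st5 ''i'' = i"
                using 1(2) st4 by (auto simp: frame_fst check_vars)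
              have "(\<exists>j<fst st4 ''s''. snd st4 ''S'' j \<noteq> fst st4 ''v'' \<and>
                  Suc (fst st4 ''k'') < snd st4 ''cnt'' (snd st4 ''S'' j)) \<longleftrightarrow>
                  (\<exists>w\<in>S. w \<noteq> v \<and> Suc k < C w)"
                using st4 by (auto simp: input_def C_def SA)
              also have "\<dots> \<longleftrightarrow> (\<exists>w\<in>S. v \<noteq> w \<and> \<not> visible {..<n} E S k v w)"
                using visv by (metis not_le)
              finally have ok5: "fst st5 ''ok'' =
                  (if \<exists>w\<in>S. v \<noteq> w \<and> \<not> visible {..<n} E S k v w then 0 else 1)"
                using 1(1) st4(4) by simp
              have "t5 \<le> t4 + 40 * s + 10"
                using 1(1) st4(1) by (simp add: input_def)
              then have t5: "t5 + 5 \<le> t2 + 2 + Suc i * (150 * n + 200 * card E + 50 * s + 200)"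
                using t' 4(1) t4 by (simp add: algebra_simps)
              have "if fst st5 ''ok'' = 1 then (\<forall>w\<in>S. D0 w \<noteq> n) \<and>
                 (\<forall>j<Suc i. \<forall>w\<in>S. A j \<noteq> w \<longrightarrow> visible {..<n} E S k (A j) w)
               else \<not> mutual_visible {..<n} E k S"
              proof (cases "\<exists>w\<in>S. v \<noteq> w \<and> \<not> visible {..<n} E S k v w")
                case True
                then show ?thesis
                  using ok5 v by (auto simp: mutual_visible_def)
              next
                case False
                then show ?thesis
                  using ok5 reach vis by (auto simp: v_def less_Suc_eq)
              qed
              then show ?case
                using t5 i st5 by (simp add: i_def[symmetric])
            qed
          qed
        qed (use st' v in \<open>auto simp: input_def inp_def i_def[symmetric] v_def\<close>)
      next
        case (3 t' st')
        have st': "input A s k st'"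
          using 3(2) st2(1) by (auto simp: input_def inp_def frame_fst frame_snd check_vars
              BFS_vars count_layers_vars)
        have "accepts st' \<longleftrightarrow> mutual_visible {..<n} E k S"
        proof (cases "fst st' ''ok'' = 1")
          case True
          then have "fst st' ''i'' = s"
            using 3 st' by (auto simp: input_def)
          then show ?thesis
            using True 3(1) by (auto simp: accepts_def mutual_visible_def SA)
        next
          case False
          then show ?thesis
            using 3(1) by (simp add: accepts_def)
        qed
        moreover have "t' \<le> t2 + 2 + fst st' ''i'' * (150 * n + 200 * card E + 50 * s + 200)"
          using 3(1) by blast
        moreover have "fst st' ''i'' * (150 * n + 200 * card E + 50 * s + 200) \<le>
            s * (150 * n + 200 * card E + 50 * s + 200)"
          using 3(1) by (intro mult_right_mono) auto
        ultimately have "t' + 8 \<le> t + 200 + (100 * n + 80 * card E + 60 * s) +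
            s * (150 * n + 200 * card E + 50 * s + 200)"
          and "accepts st' \<longleftrightarrow> mutual_visible {..<n} E k S"
          using t1 t2 by linarith+
        then show ?case
          by simp
      qed
    qed (use An in auto)
  qed (use st0 s An in \<open>auto simp: input_def inp_def\<close>)
  moreover have "200 + (100 * n + 80 * card E + 60 * s) + s * (150 * n + 200 * card E + 50 * s + 200) \<le>
      1000 * max 1 (s * (n + card E) + s\<^sup>2)"
  proof -
    \<comment> \<open>As \<open>s\<close> is positive, the lower-order terms are dominated by
      \<open>s * n\<close>, \<open>s * card E\<close> and \<open>s * s\<close>; the collected
      coefficients stay below 1000.\<close>
    have "1 \<le> s * s" "n \<le> s * n" "card E \<le> s * card E" "s \<le> s * s"
      using s by simp_all
    then have "200 + (100 * n + 80 * card E + 60 * s) + s * (150 * n + 200 * card E + 50 * s + 200) \<le>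
        1000 * (s * (n + card E) + s\<^sup>2)"
      unfolding power2_eq_square distrib_left mult.left_commute[of s] mult.commute[of s 200] by linarith
    also have "\<dots> \<le> 1000 * max 1 (s * (n + card E) + s\<^sup>2)"
      by (intro mult_left_mono max.cobounded2) simp
    finally show ?thesis .
  qed
  ultimately show ?thesis
    unfolding s_def[symmetric] by (elim wp_conseq) auto
qed

end

section \<open>Renumbering the vertices\<close>

lemma edge_image_iff:
  assumes "inj_on f V" and "\<forall>e\<in>E. e \<subseteq> V" and "x \<in> V" and "y \<in> V"
  shows "{f x, f y} \<in> (`) f ` E \<longleftrightarrow> {x, y} \<in> E"
proof
  assume "{f x, f y} \<in> (`) f ` E"
  then obtain e where e: "e \<in> E" "f ` e = f ` {x, y}"
    by auto
  then have "e = {x, y}"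
    using inj_on_image_eq_iff[OF assms(1), of e "{x, y}"] assms by auto
  then show "{x, y} \<in> E"
    using e by simp
next
  assume "{x, y} \<in> E"
  then have "f ` {x, y} \<in> (`) f ` E"
    by (rule imageI)
  then show "{f x, f y} \<in> (`) f ` E"
    by simp
qed

lemma is_path_image:
  assumes inj: "inj_on f V" and E: "\<forall>e\<in>E. e \<subseteq> V" and p: "set p \<subseteq> V" and "u \<in> V" "v \<in> V"
  shows "is_path (f ` V) ((`) f ` E) (f u) (f v) (map f p) \<longleftrightarrow> is_path V E u v p"
proof -
  have "successively (\<lambda>x y. {x, y} \<in> (`) f ` E) (map f p) \<longleftrightarrow> successively (\<lambda>x y. {x, y} \<in> E) p"
    unfolding successively_map
  proof (rule successively_cong)
    fix x y assume "x \<in> set p" "y \<in> set p"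
    then show "{f x, f y} \<in> (`) f ` E \<longleftrightarrow> {x, y} \<in> E"
      using p by (intro edge_image_iff[OF inj E]) auto
  qed simp
  moreover have "distinct (map f p) \<longleftrightarrow> distinct p"
    using inj_on_subset[OF inj p] by (simp add: distinct_map)
  moreover have "hd (map f p) = f u \<longleftrightarrow> hd p = u" "last (map f p) = f v \<longleftrightarrow> last p = v" if "p \<noteq> []"
  proof -
    have "hd p \<in> V" "last p \<in> V"
      using p hd_in_set[OF that] last_in_set[OF that] by blast+
    then show "hd (map f p) = f u \<longleftrightarrow> hd p = u" "last (map f p) = f v \<longleftrightarrow> last p = v"
      using that assms(4,5) by (simp_all add: hd_map last_map inj_on_eq_iff[OF inj])
  qed
  ultimately show ?thesis
    using p by (auto simp: is_path_def)
qed

text \<open>Lets the quantifier over competing paths in the image graph be pulled back to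
  \<open>V\<close>.\<close>

lemma is_path_preimage:
  assumes "is_path (f ` V) E' u v p"
  obtains q where "set q \<subseteq> V" "p = map f q"
proof -
  have "p \<in> lists (f ` V)"
    using assms by (auto simp: is_path_def)
  then show ?thesis
    using that by (auto simp: lists_image)
qed

lemma visible_image:
  assumes inj: "inj_on f V" and E: "\<forall>e\<in>E. e \<subseteq> V" and X: "X \<subseteq> V" and uv: "u \<in> V" "v \<in> V"
  shows "visible (f ` V) ((`) f ` E) (f ` X) k (f u) (f v) \<longleftrightarrow> visible V E X k u v"
proof -
  have path: "is_path (f ` V) ((`) f ` E) (f u) (f v) (map f p) \<longleftrightarrow> is_path V E u v p"
    if "set p \<subseteq> V" for p
    using is_path_image[OF inj E that uv] .
  have sp: "shortest_path (f ` V) ((`) f ` E) (f u) (f v) (map f p) \<longleftrightarrow> shortest_path V E u v p"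
    if "set p \<subseteq> V" for p
  proof -
    have "(\<forall>q. is_path (f ` V) ((`) f ` E) (f u) (f v) q \<longrightarrow> length p \<le> length q) \<longleftrightarrow>
        (\<forall>q. is_path V E u v q \<longrightarrow> length p \<le> length q)"
    proof (intro iffI allI impI, goal_cases)
      case (1 q)
      then have "is_path (f ` V) ((`) f ` E) (f u) (f v) (map f q)"
        using path[of q] by (simp add: is_path_def)
      then have "length p \<le> length (map f q)"
        using 1(1) by (metis length_map)
      then show ?case
        by simp
    next
      case (2 q)
      obtain r where "set r \<subseteq> V" "q = map f r"
        by (rule is_path_preimage[OF 2(2)])
      then show ?case
        using 2 path[of r] by auto
    qed
    then show ?thesis
      using path[OF that] by (simp add: shortest_path_def)
  qed
  have card: "card ((set (map f p) - {f u, f v}) \<inter> f ` X) = card ((set p - {u, v}) \<inter> X)"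
    if "set p \<subseteq> V" for p
  proof -
    have "(set (map f p) - {f u, f v}) \<inter> f ` X = f ` ((set p - {u, v}) \<inter> X)"
      using inj that X uv by (auto simp: inj_on_def)
    moreover have "inj_on f ((set p - {u, v}) \<inter> X)"
      using X by (intro inj_on_subset[OF inj]) auto
    ultimately show ?thesis
      by (simp add: card_image)
  qed
  show ?thesis
  proof
    assume "visible (f ` V) ((`) f ` E) (f ` X) k (f u) (f v)"
    then obtain p where p: "shortest_path (f ` V) ((`) f ` E) (f u) (f v) p"
      "card ((set p - {f u, f v}) \<inter> f ` X) \<le> k"
      by (auto simp: visible_def)
    have "is_path (f ` V) ((`) f ` E) (f u) (f v) p"
      using p(1) by (simp add: shortest_path_def)
    then obtain r where "set r \<subseteq> V" "p = map f r"
      by (rule is_path_preimage)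
    then show "visible V E X k u v"
      using p sp[of r] card[of r] unfolding visible_def by metis
  next
    assume "visible V E X k u v"
    then obtain p where p: "shortest_path V E u v p" "card ((set p - {u, v}) \<inter> X) \<le> k"
      by (auto simp: visible_def)
    then have "set p \<subseteq> V"
      by (simp add: shortest_path_def is_path_def)
    then show "visible (f ` V) ((`) f ` E) (f ` X) k (f u) (f v)"
      using p sp[of p] card[of p] unfolding visible_def by metis
  qed
qed

lemma mutual_visible_image:
  assumes "inj_on f V" and "\<forall>e\<in>E. e \<subseteq> V" and "X \<subseteq> V"
  shows "mutual_visible (f ` V) ((`) f ` E) k (f ` X) \<longleftrightarrow> mutual_visible V E k X"
  using visible_image[OF assms] inj_on_eq_iff[OF assms(1)] assms(3)
  unfolding mutual_visible_def by (auto simp: subset_iff)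

text \<open>\<open>num\<close> carries the graph to \<open>{..<card V}\<close> and preserves all
  cardinalities in the bound as well as visibility; the clock starts at 0.\<close>

lemma MkV_decides:
  assumes G: "simple_graph V E" and S: "S \<subseteq> V"
  shows "decides_mutual_visible_within MkV V E S k
    (1000 * max 1 (card S * (card V + card E) + (card S)\<^sup>2))"
  unfolding decides_mutual_visible_within_def
proof (intro allI impI)
  fix num st
  assume enc: "encodes num st V E S k"
  let ?E = "(`) num ` E" and ?S = "num ` S"
  have inj: "inj_on num V" and V: "num ` V = {..<card V}"
    using enc by (auto simp: encodes_def bij_betw_def)
  have EV: "\<forall>e\<in>E. e \<subseteq> V"
    using G by (simp add: simple_graph_def)
  have cardS: "card ?S = card S"
    using inj_on_subset[OF inj S] by (rule card_image)
  have "inj_on ((`) num) E"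
    using EV inj_on_image_eq_iff[OF inj] by (auto simp: inj_on_def)
  then have cardE: "card ?E = card E"
    by (rule card_image)
  interpret adjacency "card V" ?E "snd st ''off''" "snd st ''adj''"
  proof
    show "simple_graph {..<card V} ?E"
      using G V EV inj_on_subset[OF inj] unfolding simple_graph_def
      by (auto simp: card_image)
  next
    fix i assume "i < card V"
    then obtain u where u: "u \<in> V" "i = num u"
      using V by blast
    \<comment> \<open>The encoding lists the numbers of the neighbours of \<open>u\<close>; they are
      exactly the neighbours of \<open>num u\<close> in the image graph.\<close>
    have "{w. {num u, w} \<in> ?E} = num ` {w \<in> V. {u, w} \<in> E}"
    proof (intro equalityI subsetI)
      fix w assume w: "w \<in> {w. {num u, w} \<in> ?E}"
      then obtain x where "x \<in> V" "w = num x"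
        using EV by blast
      then show "w \<in> num ` {w \<in> V. {u, w} \<in> E}"
        using w edge_image_iff[OF inj EV u(1)] by auto
    next
      fix w assume "w \<in> num ` {w \<in> V. {u, w} \<in> E}"
      then show "w \<in> {w. {num u, w} \<in> ?E}"
        using edge_image_iff[OF inj EV u(1)] by auto
    qed
    then show "bij_betw (snd st ''adj'') {snd st ''off'' i..<snd st ''off'' (Suc i)} {w. {i, w} \<in> ?E}"
      using enc u by (simp add: encodes_def)
  qed (use enc in \<open>auto simp: encodes_def\<close>)
  have "wp MkV (\<lambda>t' st'. t' \<le> 0 + 1000 * max 1 (card ?S * (card V + card ?E) + (card ?S)\<^sup>2) \<and>
     (accepts st' \<longleftrightarrow> mutual_visible {..<card V} ?E k ?S)) 0 st"
    using enc V S by (intro wp_MkV[where A = "snd st ''S''"]) (auto simp: input_def inp_def encodes_def cardS)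
  then show "\<exists>t st'. exec MkV st t st' \<and>
      t \<le> 1000 * max 1 (card S * (card V + card E) + (card S)\<^sup>2) \<and>
      (accepts st' \<longleftrightarrow> mutual_visible V E k S)"
    using mutual_visible_image[OF inj EV S] by (simp add: wp_def V cardS cardE)
qed

lemma decides_mutual_visible_within_mono:
  "decides_mutual_visible_within c V E S k T \<Longrightarrow> T \<le> T' \<Longrightarrow> decides_mutual_visible_within c V E S k T'"
  unfolding decides_mutual_visible_within_def by (meson order_trans)

theorem theorem6p2:
  shows "(\<exists>C::nat. \<forall>(V::'a set) E S k. simple_graph V E \<and> S \<subseteq> V \<longrightarrow>
           decides_mutual_visible_within MkV V E S k
             (C * max 1 (card S * (card V + card E) + (card S)\<^sup>2)))
       \<and> (\<exists>p::nat poly. \<forall>(V::'a set) E S k. simple_graph V E \<and> S \<subseteq> V \<longrightarrow>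
           decides_mutual_visible_within MkV V E S k (poly p (card V + card E)))"
proof
  show "\<exists>C::nat. \<forall>(V::'a set) E S k. simple_graph V E \<and> S \<subseteq> V \<longrightarrow>
           decides_mutual_visible_within MkV V E S k
             (C * max 1 (card S * (card V + card E) + (card S)\<^sup>2))"
    using MkV_decides by blast
next
  \<comment> \<open>With \<open>N = card V + card E\<close> and \<open>card S <= N\<close>, both
    summands of the bound are at most \<open>N * N\<close>, which leads to
    \<open>1000 * (1 + 2 * (N * N))\<close>.\<close>
  have "decides_mutual_visible_within MkV V E S k (poly [:1000, 0, 2000:] (card V + card E))"
    if G: "simple_graph V E" and S: "S \<subseteq> V" for V :: "'a set" and E S k
  proof (rule decides_mutual_visible_within_mono[OF MkV_decides[OF G S]])
    let ?N = "card V + card E"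
    have "card S \<le> ?N"
      using G S by (auto simp: simple_graph_def intro: trans_le_add1 card_mono)
    then have "card S * ?N \<le> ?N * ?N" "card S * card S \<le> ?N * ?N"
      by (auto intro: mult_le_mono)
    then have "max 1 (card S * ?N + (card S)\<^sup>2) \<le> 1 + 2 * (?N * ?N)"
      unfolding power2_eq_square by linarith
    also have "1000 * \<dots> = poly [:1000, 0, 2000:] ?N"
      by (simp add: algebra_simps)
    finally show "1000 * max 1 (card S * ?N + (card S)\<^sup>2) \<le> poly [:1000, 0, 2000:] ?N"
      by simp
  qed
  then show "\<exists>p::nat poly. \<forall>(V::'a set) E S k. simple_graph V E \<and> S \<subseteq> V \<longrightarrow>
           decides_mutual_visible_within MkV V E S k (poly p (card V + card E))"
    by blast
qed

end
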